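(* Let $\mathcal{Q}$ be a small quantaloid. Given a $\mathcal{Q}$-distributor $\phi$ from $\mathbb{A}$ to $\mathbb{B}$ and $\mathcal{Q}$-subcategories $\mathbb{A}'\subseteq\mathbb{A}$, $\mathbb{B}'\subseteq\mathbb{B}$, consider the comparison $\mathcal{Q}$-functors $R_1,R_2:\mathcal{M}\phi\to\mathcal{M}\phi_{\mathbb{A}',\mathbb{B}'}$ and $E_1,E_2:\mathcal{M}\phi_{\mathbb{A}',\mathbb{B}'}\to\mathcal{M}\phi$. If one of the $\mathcal{Q}$-functors $R_1$, $R_2$, $E_1$, $E_2$ is an isomorphism in $\mathcal{Q}\text{-}\mathbf{Cat}$, then so are the other three.
   Context: A quantaloid is a category whose hom-sets are complete lattices and whose composition preserves arbitrary joins in each variable. For arrows $f:X\to Y$, $g:Y\to Z$, $h:X\to Z$ the implications $h\swarrow f:Y\to Z$ and $g\searrow h:X\to Y$ are determined by $g\circ f\leq h\iff g\leq h\swarrow f\iff f\leq g\searrow h$. A $\mathcal{Q}$-category $\mathbb{A}$ is a set $\mathbb{A}_0$ with a type map $t:\mathbb{A}_0\to\mathrm{ob}\,\mathcal{Q}$ and hom-arrows $\mathbb{A}(x,y)\in\mathcal{Q}(tx,ty)$ with $1_{tx}\leq\mathbb{A}(x,x)$ and $\mathbb{A}(y,z)\circ\mathbb{A}(x,y)\leq\mathbb{A}(x,z)$. Its underlying preorder is: $x\leq y$ iff $tx=ty$ and $1_{tx}\leq\mathbb{A}(x,y)$; $\mathbb{A}$ is skeletal if this is a partial order. A $\mathcal{Q}$-subcategory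 $\mathbb{A}'\subseteq\mathbb{A}$ is given by a subset of objects with the inherited hom-arrows. A $\mathcal{Q}$-functor $F:\mathbb{A}\to\mathbb{B}$ is a type-preserving map with $\mathbb{A}(x,y)\leq\mathbb{B}(Fx,Fy)$; $\mathcal{Q}$-functors are ordered pointwise, giving the locally ordered 2-category $\mathcal{Q}\text{-}\mathbf{Cat}$, in which adjunctions are taken. A $\mathcal{Q}$-distributor $\phi$ from $\mathbb{A}$ to $\mathbb{B}$ assigns to each $(x,y)\in\mathbb{A}_0\times\mathbb{B}_0$ an arrow $\phi(x,y)\in\mathcal{Q}(tx,ty)$ with $\mathbb{B}(y,y')\circ\phi(x,y)\circ\mathbb{A}(x',x)\leq\phi(x',y')$. With $(\psi\circ\phi)(x,z)=\bigvee_{y}\psi(y,z)\circ\phi(x,y)$, identities $\mathbb{A}$ and the pointwise order, these form a quantaloid $\mathcal{Q}\text{-}\mathbf{Dist}$. A $\mathcal{Q}$-functor $F:\mathbb{A}\to\mathbb{B}$ induces its graph $F_{\natural}(x,y)=\mathbb{B}(Fx,y)$ (from $\mathbb{A}$ to $\mathbb{B}$) and cograph $F^{\natural}(y,x)=\mathbb{B}(y,Fx)$ (from $\mathbb{B}$ to $\mathbb{A}$). A Chu connection from $\phi$ (from $\mathbb{A}$ to $\mathbb{B}$) to $\psi$ (from $\mathbb{C}$ to $\mathbb{D}$) is a pair of $\mathcal{Q}$-distributors $(\zeta,\eta)$, $\zeta$ from $\mathbb{A}$ to $\mathbb{C}$ and $\eta$ from $\mathbb{B}$ to $\mathbb{D}$,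 with $\phi\swarrow\zeta=\eta\searrow\psi$. For $X\in\mathrm{ob}\,\mathcal{Q}$, $*_X$ is the $\mathcal{Q}$-category with one object, of type $X$, and hom-arrow $1_X$. $\mathcal{P}\mathbb{A}$ has as objects of type $X$ the $\mathcal{Q}$-distributors $\mu$ from $\mathbb{A}$ to $*_X$, with $\mathcal{P}\mathbb{A}(\mu,\mu')=\mu'\swarrow\mu$; $\mathcal{P}^{\dagger}\mathbb{A}$ has as objects of type $X$ the $\mathcal{Q}$-distributors $\lambda$ from $*_X$ to $\mathbb{A}$, with $\mathcal{P}^{\dagger}\mathbb{A}(\lambda,\lambda')=\lambda'\searrow\lambda$. Each $\phi$ from $\mathbb{A}$ to $\mathbb{B}$ induces an adjunction $\phi_{\uparrow}\dashv\phi^{\downarrow}$ with $\phi_{\uparrow}:\mathcal{P}\mathbb{A}\to\mathcal{P}^{\dagger}\mathbb{B}$, $\mu\mapsto\phi\swarrow\mu$, and $\phi^{\downarrow}:\mathcal{P}^{\dagger}\mathbb{B}\to\mathcal{P}\mathbb{A}$, $\lambda\mapsto\lambda\searrow\phi$. $\mathcal{M}\phi$ is the full $\mathcal{Q}$-subcategory of $\mathcal{P}\mathbb{A}$ on those $\mu$ with $\phi^{\downarrow}\phi_{\uparrow}\mu=\mu$ (it is skeletal and complete). A Chu connection $(\zeta,\eta):\phi\to\psi$ induces a left adjoint $\mathcal{Q}$-functor $\mathcal{M}(\zeta,\eta):\mathcal{M}\psi\to\mathcal{M}\phi$, $\mu'\mapsto\phi^{\downarrow}\phi_{\uparrow}(\mu'\circ\zeta)$.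 Let $I:\mathbb{A}'\to\mathbb{A}$ and $J:\mathbb{B}'\to\mathbb{B}$ be the inclusions and let $\phi_{\mathbb{A}',\mathbb{B}'}$ denote the restriction of $\phi$ to $\mathbb{A}'$ and $\mathbb{B}'$ (similarly $\phi_{\mathbb{A}',\mathbb{B}}$, $\phi_{\mathbb{A},\mathbb{B}'}$). Then $(\mathbb{A},J_{\natural}):\phi_{\mathbb{A},\mathbb{B}'}\to\phi$, $(I^{\natural},\mathbb{B}):\phi\to\phi_{\mathbb{A}',\mathbb{B}}$, $(\mathbb{A}',J_{\natural}):\phi_{\mathbb{A}',\mathbb{B}'}\to\phi_{\mathbb{A}',\mathbb{B}}$ and $(I^{\natural},\mathbb{B}'):\phi_{\mathbb{A},\mathbb{B}'}\to\phi_{\mathbb{A}',\mathbb{B}'}$ are Chu connections, so there are left adjoint $\mathcal{Q}$-functors $\mathcal{M}(\mathbb{A},J_{\natural}):\mathcal{M}\phi\to\mathcal{M}\phi_{\mathbb{A},\mathbb{B}'}$, $\mathcal{M}(I^{\natural},\mathbb{B}):\mathcal{M}\phi_{\mathbb{A}',\mathbb{B}}\to\mathcal{M}\phi$, $\mathcal{M}(\mathbb{A}',J_{\natural}):\mathcal{M}\phi_{\mathbb{A}',\mathbb{B}}\to\mathcal{M}\phi_{\mathbb{A}',\mathbb{B}'}$, $\mathcal{M}(I^{\natural},\mathbb{B}'):\mathcal{M}\phi_{\mathbb{A}',\mathbb{B}'}\to\mathcal{M}\phi_{\mathbb{A},\mathbb{B}'}$. The comparison $\mathcal{Q}$-functors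 are: - $R_1$: the right adjoint of $\mathcal{M}(I^{\natural},\mathbb{B})$ followed by $\mathcal{M}(\mathbb{A}',J_{\natural})$; - $R_2$: $\mathcal{M}(\mathbb{A},J_{\natural})$ followed by the right adjoint of $\mathcal{M}(I^{\natural},\mathbb{B}')$; - $E_1$: the right adjoint of $\mathcal{M}(\mathbb{A}',J_{\natural})$ followed by $\mathcal{M}(I^{\natural},\mathbb{B})$; - $E_2$: $\mathcal{M}(I^{\natural},\mathbb{B}')$ followed by the right adjoint of $\mathcal{M}(\mathbb{A},J_{\natural})$. *)

theory Defs
  imports "HOL-Algebra.Complete_Lattice"
begin

section \<open>Small quantaloids\<close>

text \<open>
  Composition and identities are indexed by objects, so hom-sets need not be disjoint:
  \<open>Comp Q X Y Z g f\<close> is \<open>g \<circ> f\<close> for \<open>f : X \<rightarrow> Y\<close> and \<open>g : Y \<rightarrow> Z\<close>.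
\<close>

record ('o, 'a) quantaloid_data =
  Ob :: "'o set"
  Hom :: "'o \<Rightarrow> 'o \<Rightarrow> 'a gorder"
  Ident :: "'o \<Rightarrow> 'a"
  Comp :: "'o \<Rightarrow> 'o \<Rightarrow> 'o \<Rightarrow> 'a \<Rightarrow> 'a \<Rightarrow> 'a"

locale quantaloid =
  fixes Q :: "('o, 'a) quantaloid_data"
  assumes hom_complete_lattice:
      "\<lbrakk>X \<in> Ob Q; Y \<in> Ob Q\<rbrakk> \<Longrightarrow> complete_lattice (Hom Q X Y)"
    and ident_closed:
      "X \<in> Ob Q \<Longrightarrow> Ident Q X \<in> carrier (Hom Q X X)"
    and comp_closed:
      "\<lbrakk>X \<in> Ob Q; Y \<in> Ob Q; Z \<in> Ob Q;
        f \<in> carrier (Hom Q X Y); g \<in> carrier (Hom Q Y Z)\<rbrakk>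
       \<Longrightarrow> Comp Q X Y Z g f \<in> carrier (Hom Q X Z)"
    and comp_assoc:
      "\<lbrakk>W \<in> Ob Q; X \<in> Ob Q; Y \<in> Ob Q; Z \<in> Ob Q;
        f \<in> carrier (Hom Q W X); g \<in> carrier (Hom Q X Y); h \<in> carrier (Hom Q Y Z)\<rbrakk>
       \<Longrightarrow> Comp Q W X Z (Comp Q X Y Z h g) f = Comp Q W Y Z h (Comp Q W X Y g f)"
    and comp_ident_left:
      "\<lbrakk>X \<in> Ob Q; Y \<in> Ob Q; f \<in> carrier (Hom Q X Y)\<rbrakk>
       \<Longrightarrow> Comp Q X Y Y (Ident Q Y) f = f"
    and comp_ident_right:
      "\<lbrakk>X \<in> Ob Q; Y \<in> Ob Q; f \<in> carrier (Hom Q X Y)\<rbrakk>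
       \<Longrightarrow> Comp Q X X Y f (Ident Q X) = f"
    and comp_sup_left:
      "\<lbrakk>X \<in> Ob Q; Y \<in> Ob Q; Z \<in> Ob Q;
        f \<in> carrier (Hom Q X Y); G \<subseteq> carrier (Hom Q Y Z)\<rbrakk>
       \<Longrightarrow> Comp Q X Y Z (\<Squnion>\<^bsub>Hom Q Y Z\<^esub> G) f
           = \<Squnion>\<^bsub>Hom Q X Z\<^esub> ((\<lambda>g. Comp Q X Y Z g f) ` G)"
    and comp_sup_right:
      "\<lbrakk>X \<in> Ob Q; Y \<in> Ob Q; Z \<in> Ob Q;
        F \<subseteq> carrier (Hom Q X Y); g \<in> carrier (Hom Q Y Z)\<rbrakk>
       \<Longrightarrow> Comp Q X Y Z g (\<Squnion>\<^bsub>Hom Q X Y\<^esub> F)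
           = \<Squnion>\<^bsub>Hom Q X Z\<^esub> ((\<lambda>f. Comp Q X Y Z g f) ` F)"


section \<open>Categories and functors over a quantaloid\<close>

record ('x, 'o, 'a) qcat =
  Obj :: "'x set"
  Typ :: "'x \<Rightarrow> 'o"
  Arr :: "'x \<Rightarrow> 'x \<Rightarrow> 'a"

definition qcategory :: "('o, 'a) quantaloid_data \<Rightarrow> ('x, 'o, 'a) qcat \<Rightarrow> bool" where
  "qcategory Q A \<longleftrightarrow>
     (\<forall>x\<in>Obj A. Typ A x \<in> Ob Q) \<and>
     (\<forall>x\<in>Obj A. \<forall>y\<in>Obj A. Arr A x y \<in> carrier (Hom Q (Typ A x) (Typ A y))) \<and>
     (\<forall>x\<in>Obj A. Ident Q (Typ A x) \<sqsubseteq>\<^bsub>Hom Q (Typ A x) (Typ A x)\<^esub> Arr A x x) \<and>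
     (\<forall>x\<in>Obj A. \<forall>y\<in>Obj A. \<forall>z\<in>Obj A.
        Comp Q (Typ A x) (Typ A y) (Typ A z) (Arr A y z) (Arr A x y)
          \<sqsubseteq>\<^bsub>Hom Q (Typ A x) (Typ A z)\<^esub> Arr A x z)"

definition qle :: "('o, 'a) quantaloid_data \<Rightarrow> ('x, 'o, 'a) qcat \<Rightarrow> 'x \<Rightarrow> 'x \<Rightarrow> bool" where
  "qle Q A x y \<longleftrightarrow>
     Typ A x = Typ A y \<and> Ident Q (Typ A x) \<sqsubseteq>\<^bsub>Hom Q (Typ A x) (Typ A x)\<^esub> Arr A x y"

definition full_sub :: "('x, 'o, 'a) qcat \<Rightarrow> 'x set \<Rightarrow> ('x, 'o, 'a) qcat" where
  "full_sub A S = A\<lparr>Obj := S\<rparr>"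

text \<open>
  Functors (and, below, distributors) are extensional functions on the object sets, so that
  equality of functors is HOL equality.
\<close>

definition qfunctor ::
  "('o, 'a) quantaloid_data \<Rightarrow> ('x, 'o, 'a) qcat \<Rightarrow> ('y, 'o, 'a) qcat \<Rightarrow> ('x \<Rightarrow> 'y) \<Rightarrow> bool" where
  "qfunctor Q A B F \<longleftrightarrow>
     F \<in> Obj A \<rightarrow>\<^sub>E Obj B \<and>
     (\<forall>x\<in>Obj A. Typ B (F x) = Typ A x) \<and>
     (\<forall>x\<in>Obj A. \<forall>y\<in>Obj A. Arr A x y \<sqsubseteq>\<^bsub>Hom Q (Typ A x) (Typ A y)\<^esub> Arr B (F x) (F y))"

definition functor_id :: "('x, 'o, 'a) qcat \<Rightarrow> 'x \<Rightarrow> 'x" where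
  "functor_id A = (\<lambda>x\<in>Obj A. x)"

definition functor_le ::
  "('o, 'a) quantaloid_data \<Rightarrow> ('x, 'o, 'a) qcat \<Rightarrow> ('y, 'o, 'a) qcat
    \<Rightarrow> ('x \<Rightarrow> 'y) \<Rightarrow> ('x \<Rightarrow> 'y) \<Rightarrow> bool" where
  "functor_le Q A B F G \<longleftrightarrow> (\<forall>x\<in>Obj A. qle Q B (F x) (G x))"

definition qadjunction ::
  "('o, 'a) quantaloid_data \<Rightarrow> ('x, 'o, 'a) qcat \<Rightarrow> ('y, 'o, 'a) qcat
    \<Rightarrow> ('x \<Rightarrow> 'y) \<Rightarrow> ('y \<Rightarrow> 'x) \<Rightarrow> bool" where
  "qadjunction Q A B F G \<longleftrightarrow>
     qfunctor Q A B F \<and> qfunctor Q B A G \<and>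
     functor_le Q A A (functor_id A) (compose (Obj A) G F) \<and>
     functor_le Q B B (compose (Obj B) F G) (functor_id B)"

text \<open>
  A right adjoint is unique when \<open>A\<close> is skeletal, which is the only case in which
  the following is used.
\<close>

definition right_adjoint ::
  "('o, 'a) quantaloid_data \<Rightarrow> ('x, 'o, 'a) qcat \<Rightarrow> ('y, 'o, 'a) qcat
    \<Rightarrow> ('x \<Rightarrow> 'y) \<Rightarrow> ('y \<Rightarrow> 'x)" where
  "right_adjoint Q A B F = (THE G. qadjunction Q A B F G)"

definition qisomorphism ::
  "('o, 'a) quantaloid_data \<Rightarrow> ('x, 'o, 'a) qcat \<Rightarrow> ('y, 'o, 'a) qcat \<Rightarrow> ('x \<Rightarrow> 'y) \<Rightarrow> bool" where
  "qisomorphism Q A B F \<longleftrightarrow>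
     qfunctor Q A B F \<and>
     (\<exists>G. qfunctor Q B A G \<and>
          compose (Obj A) G F = functor_id A \<and> compose (Obj B) F G = functor_id B)"


section \<open>Distributors\<close>

definition Dist ::
  "('o, 'a) quantaloid_data \<Rightarrow> ('x, 'o, 'a) qcat \<Rightarrow> ('y, 'o, 'a) qcat \<Rightarrow> ('x \<Rightarrow> 'y \<Rightarrow> 'a) set" where
  "Dist Q A B =
     {\<phi> \<in> (\<Pi>\<^sub>E x\<in>Obj A. \<Pi>\<^sub>E y\<in>Obj B. carrier (Hom Q (Typ A x) (Typ B y))).
        \<forall>x\<in>Obj A. \<forall>x'\<in>Obj A. \<forall>y\<in>Obj B. \<forall>y'\<in>Obj B.
          Comp Q (Typ A x') (Typ B y) (Typ B y') (Arr B y y')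
            (Comp Q (Typ A x') (Typ A x) (Typ B y) (\<phi> x y) (Arr A x' x))
            \<sqsubseteq>\<^bsub>Hom Q (Typ A x') (Typ B y')\<^esub> \<phi> x' y'}"

definition dist_le ::
  "('o, 'a) quantaloid_data \<Rightarrow> ('x, 'o, 'a) qcat \<Rightarrow> ('y, 'o, 'a) qcat
    \<Rightarrow> ('x \<Rightarrow> 'y \<Rightarrow> 'a) \<Rightarrow> ('x \<Rightarrow> 'y \<Rightarrow> 'a) \<Rightarrow> bool" where
  "dist_le Q A B \<phi> \<psi> \<longleftrightarrow>
     (\<forall>x\<in>Obj A. \<forall>y\<in>Obj B. \<phi> x y \<sqsubseteq>\<^bsub>Hom Q (Typ A x) (Typ B y)\<^esub> \<psi> x y)"

definition dist_id :: "('x, 'o, 'a) qcat \<Rightarrow> 'x \<Rightarrow> 'x \<Rightarrow> 'a" where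
  "dist_id A = (\<lambda>x\<in>Obj A. \<lambda>y\<in>Obj A. Arr A x y)"

definition dist_comp ::
  "('o, 'a) quantaloid_data \<Rightarrow> ('x, 'o, 'a) qcat \<Rightarrow> ('y, 'o, 'a) qcat \<Rightarrow> ('z, 'o, 'a) qcat
    \<Rightarrow> ('y \<Rightarrow> 'z \<Rightarrow> 'a) \<Rightarrow> ('x \<Rightarrow> 'y \<Rightarrow> 'a) \<Rightarrow> ('x \<Rightarrow> 'z \<Rightarrow> 'a)" where
  "dist_comp Q A B C \<psi> \<phi> =
     (\<lambda>x\<in>Obj A. \<lambda>z\<in>Obj C.
        \<Squnion>\<^bsub>Hom Q (Typ A x) (Typ C z)\<^esub>
          ((\<lambda>y. Comp Q (Typ A x) (Typ B y) (Typ C z) (\<psi> y z) (\<phi> x y)) ` Obj B))"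

text \<open>
  The implications of the quantaloid of distributors, given by their universal properties:
  for \<open>\<phi> : A \<rightarrow> B\<close>, \<open>\<psi> : B \<rightarrow> C\<close>, \<open>\<theta> : A \<rightarrow> C\<close>, the distributor \<open>left_impl Q A B C \<theta> \<phi>\<close>
  is \<open>\<theta> \<swarrow> \<phi> : B \<rightarrow> C\<close>, and \<open>right_impl Q A B C \<psi> \<theta>\<close> is \<open>\<psi> \<searrow> \<theta> : A \<rightarrow> B\<close>.
\<close>

definition left_impl ::
  "('o, 'a) quantaloid_data \<Rightarrow> ('x, 'o, 'a) qcat \<Rightarrow> ('y, 'o, 'a) qcat \<Rightarrow> ('z, 'o, 'a) qcat
    \<Rightarrow> ('x \<Rightarrow> 'z \<Rightarrow> 'a) \<Rightarrow> ('x \<Rightarrow> 'y \<Rightarrow> 'a) \<Rightarrow> ('y \<Rightarrow> 'z \<Rightarrow> 'a)" where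
  "left_impl Q A B C \<theta> \<phi> =
     (THE \<chi>. \<chi> \<in> Dist Q B C \<and>
        (\<forall>\<psi>\<in>Dist Q B C. dist_le Q A C (dist_comp Q A B C \<psi> \<phi>) \<theta> \<longleftrightarrow> dist_le Q B C \<psi> \<chi>))"

definition right_impl ::
  "('o, 'a) quantaloid_data \<Rightarrow> ('x, 'o, 'a) qcat \<Rightarrow> ('y, 'o, 'a) qcat \<Rightarrow> ('z, 'o, 'a) qcat
    \<Rightarrow> ('y \<Rightarrow> 'z \<Rightarrow> 'a) \<Rightarrow> ('x \<Rightarrow> 'z \<Rightarrow> 'a) \<Rightarrow> ('x \<Rightarrow> 'y \<Rightarrow> 'a)" where
  "right_impl Q A B C \<psi> \<theta> =
     (THE \<chi>. \<chi> \<in> Dist Q A B \<and>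
        (\<forall>\<phi>\<in>Dist Q A B. dist_le Q A C (dist_comp Q A B C \<psi> \<phi>) \<theta> \<longleftrightarrow> dist_le Q A B \<phi> \<chi>))"

definition graph :: "('x, 'o, 'a) qcat \<Rightarrow> ('y, 'o, 'a) qcat \<Rightarrow> ('x \<Rightarrow> 'y) \<Rightarrow> 'x \<Rightarrow> 'y \<Rightarrow> 'a" where
  "graph A B F = (\<lambda>x\<in>Obj A. \<lambda>y\<in>Obj B. Arr B (F x) y)"

definition cograph :: "('x, 'o, 'a) qcat \<Rightarrow> ('y, 'o, 'a) qcat \<Rightarrow> ('x \<Rightarrow> 'y) \<Rightarrow> 'y \<Rightarrow> 'x \<Rightarrow> 'a" where
  "cograph A B F = (\<lambda>y\<in>Obj B. \<lambda>x\<in>Obj A. Arr B y (F x))"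

definition chu_connection ::
  "('o, 'a) quantaloid_data
    \<Rightarrow> ('x, 'o, 'a) qcat \<Rightarrow> ('y, 'o, 'a) qcat \<Rightarrow> ('x \<Rightarrow> 'y \<Rightarrow> 'a)
    \<Rightarrow> ('u, 'o, 'a) qcat \<Rightarrow> ('v, 'o, 'a) qcat \<Rightarrow> ('u \<Rightarrow> 'v \<Rightarrow> 'a)
    \<Rightarrow> ('x \<Rightarrow> 'u \<Rightarrow> 'a) \<times> ('y \<Rightarrow> 'v \<Rightarrow> 'a) \<Rightarrow> bool" where
  "chu_connection Q A B \<phi> C D \<psi> = (\<lambda>(\<zeta>, \<eta>).
     \<zeta> \<in> Dist Q A C \<and> \<eta> \<in> Dist Q B D \<and>
     left_impl Q A C B \<phi> \<zeta> = right_impl Q C B D \<eta> \<psi>)"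


section \<open>Presheaves and the concept category of a distributor\<close>

definition star :: "('o, 'a) quantaloid_data \<Rightarrow> 'o \<Rightarrow> (unit, 'o, 'a) qcat" where
  "star Q X = \<lparr>Obj = {()}, Typ = (\<lambda>_. X), Arr = (\<lambda>_ _. Ident Q X)\<rparr>"

text \<open>
  A (co)presheaf is paired with its type, which cannot be recovered from the underlying
  function, e.g. when \<open>A\<close> is empty.  Distributors from \<open>star Q X\<close> to \<open>star Q Y\<close> are
  identified with arrows \<open>X \<rightarrow> Y\<close> of \<open>Q\<close> by evaluation at the unique objects.
\<close>

type_synonym ('x, 'o, 'a) presheaf = "'o \<times> ('x \<Rightarrow> unit \<Rightarrow> 'a)"
type_synonym ('x, 'o, 'a) copresheaf = "'o \<times> (unit \<Rightarrow> 'x \<Rightarrow> 'a)"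

definition PSh ::
  "('o, 'a) quantaloid_data \<Rightarrow> ('x, 'o, 'a) qcat \<Rightarrow> (('x, 'o, 'a) presheaf, 'o, 'a) qcat" where
  "PSh Q A =
     \<lparr>Obj = {(X, \<mu>). X \<in> Ob Q \<and> \<mu> \<in> Dist Q A (star Q X)},
      Typ = fst,
      Arr = (\<lambda>(X, \<mu>) (X', \<mu>'). left_impl Q A (star Q X) (star Q X') \<mu>' \<mu> () ())\<rparr>"

text \<open>\<open>isbell_up\<close> and \<open>isbell_down\<close> are \<open>\<phi>\<^sub>\<up>\<close> and \<open>\<phi>\<^sup>\<down>\<close>.\<close>

definition isbell_up ::
  "('o, 'a) quantaloid_data \<Rightarrow> ('x, 'o, 'a) qcat \<Rightarrow> ('y, 'o, 'a) qcat \<Rightarrow> ('x \<Rightarrow> 'y \<Rightarrow> 'a)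
    \<Rightarrow> ('x, 'o, 'a) presheaf \<Rightarrow> ('y, 'o, 'a) copresheaf" where
  "isbell_up Q A B \<phi> = (\<lambda>(X, \<mu>). (X, left_impl Q A (star Q X) B \<phi> \<mu>))"

definition isbell_down ::
  "('o, 'a) quantaloid_data \<Rightarrow> ('x, 'o, 'a) qcat \<Rightarrow> ('y, 'o, 'a) qcat \<Rightarrow> ('x \<Rightarrow> 'y \<Rightarrow> 'a)
    \<Rightarrow> ('y, 'o, 'a) copresheaf \<Rightarrow> ('x, 'o, 'a) presheaf" where
  "isbell_down Q A B \<phi> = (\<lambda>(X, \<nu>). (X, right_impl Q A (star Q X) B \<nu> \<phi>))"

definition M_cat ::
  "('o, 'a) quantaloid_data \<Rightarrow> ('x, 'o, 'a) qcat \<Rightarrow> ('y, 'o, 'a) qcat \<Rightarrow> ('x \<Rightarrow> 'y \<Rightarrow> 'a)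
    \<Rightarrow> (('x, 'o, 'a) presheaf, 'o, 'a) qcat" where
  "M_cat Q A B \<phi> =
     full_sub (PSh Q A)
       {m \<in> Obj (PSh Q A). isbell_down Q A B \<phi> (isbell_up Q A B \<phi> m) = m}"

text \<open>
  For a Chu connection \<open>(\<zeta>, \<eta>) : \<phi> \<rightarrow> \<psi>\<close> this is the functor \<open>M(\<zeta>, \<eta>)\<close> from \<open>M_cat\<close> of \<open>\<psi>\<close>
  to \<open>M_cat\<close> of \<open>\<phi>\<close>; its values do not involve \<open>\<eta>\<close>.
\<close>

definition M_map ::
  "('o, 'a) quantaloid_data
    \<Rightarrow> ('x, 'o, 'a) qcat \<Rightarrow> ('y, 'o, 'a) qcat \<Rightarrow> ('x \<Rightarrow> 'y \<Rightarrow> 'a)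
    \<Rightarrow> ('u, 'o, 'a) qcat \<Rightarrow> ('v, 'o, 'a) qcat \<Rightarrow> ('u \<Rightarrow> 'v \<Rightarrow> 'a)
    \<Rightarrow> ('x \<Rightarrow> 'u \<Rightarrow> 'a) \<times> ('y \<Rightarrow> 'v \<Rightarrow> 'a)
    \<Rightarrow> ('u, 'o, 'a) presheaf \<Rightarrow> ('x, 'o, 'a) presheaf" where
  "M_map Q A B \<phi> C D \<psi> = (\<lambda>(\<zeta>, \<eta>). \<lambda>m \<in> Obj (M_cat Q C D \<psi>).
     isbell_down Q A B \<phi> (isbell_up Q A B \<phi>
       (fst m, dist_comp Q A C (star Q (fst m)) (snd m) \<zeta>)))"


section \<open>Restrictions and comparison functors\<close>

definition dist_restrict :: "'x set \<Rightarrow> 'y set \<Rightarrow> ('x \<Rightarrow> 'y \<Rightarrow> 'a) \<Rightarrow> 'x \<Rightarrow> 'y \<Rightarrow> 'a" where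
  "dist_restrict S T \<phi> = (\<lambda>x\<in>S. \<lambda>y\<in>T. \<phi> x y)"

definition incl_graph :: "('y, 'o, 'a) qcat \<Rightarrow> 'y set \<Rightarrow> 'y \<Rightarrow> 'y \<Rightarrow> 'a" where
  "incl_graph B T = graph (full_sub B T) B (functor_id (full_sub B T))"

definition incl_cograph :: "('x, 'o, 'a) qcat \<Rightarrow> 'x set \<Rightarrow> 'x \<Rightarrow> 'x \<Rightarrow> 'a" where
  "incl_cograph A S = cograph (full_sub A S) A (functor_id (full_sub A S))"

definition M_sub ::
  "('o, 'a) quantaloid_data \<Rightarrow> ('x, 'o, 'a) qcat \<Rightarrow> ('y, 'o, 'a) qcat \<Rightarrow> ('x \<Rightarrow> 'y \<Rightarrow> 'a)
    \<Rightarrow> 'x set \<Rightarrow> 'y set \<Rightarrow> (('x, 'o, 'a) presheaf, 'o, 'a) qcat" where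
  "M_sub Q A B \<phi> S T = M_cat Q (full_sub A S) (full_sub B T) (dist_restrict S T \<phi>)"

text \<open>
  With \<open>A' = full_sub A S\<close> and \<open>B' = full_sub B T\<close>:
  \<open>M_incl_cod Q A B \<phi> S T\<close> is \<open>M(A', J\<^sub>\<natural>) : M \<phi>\<^bsub>A',B\<^esub> \<rightarrow> M \<phi>\<^bsub>A',B'\<^esub>\<close> and
  \<open>M_incl_dom Q A B \<phi> S T\<close> is \<open>M(I\<^sup>\<natural>, B') : M \<phi>\<^bsub>A',B'\<^esub> \<rightarrow> M \<phi>\<^bsub>A,B'\<^esub>\<close>.  The cases
  \<open>S = Obj A\<close> and \<open>T = Obj B\<close> respectively give \<open>M(A, J\<^sub>\<natural>)\<close> and \<open>M(I\<^sup>\<natural>, B)\<close>, since then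
  \<open>full_sub A S = A\<close> and \<open>full_sub B T = B\<close>.
\<close>

definition M_incl_cod ::
  "('o, 'a) quantaloid_data \<Rightarrow> ('x, 'o, 'a) qcat \<Rightarrow> ('y, 'o, 'a) qcat \<Rightarrow> ('x \<Rightarrow> 'y \<Rightarrow> 'a)
    \<Rightarrow> 'x set \<Rightarrow> 'y set \<Rightarrow> ('x, 'o, 'a) presheaf \<Rightarrow> ('x, 'o, 'a) presheaf" where
  "M_incl_cod Q A B \<phi> S T =
     M_map Q (full_sub A S) (full_sub B T) (dist_restrict S T \<phi>)
             (full_sub A S) B (dist_restrict S (Obj B) \<phi>)
             (dist_id (full_sub A S), incl_graph B T)"

definition M_incl_dom ::
  "('o, 'a) quantaloid_data \<Rightarrow> ('x, 'o, 'a) qcat \<Rightarrow> ('y, 'o, 'a) qcat \<Rightarrow> ('x \<Rightarrow> 'y \<Rightarrow> 'a)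
    \<Rightarrow> 'x set \<Rightarrow> 'y set \<Rightarrow> ('x, 'o, 'a) presheaf \<Rightarrow> ('x, 'o, 'a) presheaf" where
  "M_incl_dom Q A B \<phi> S T =
     M_map Q A (full_sub B T) (dist_restrict (Obj A) T \<phi>)
             (full_sub A S) (full_sub B T) (dist_restrict S T \<phi>)
             (incl_cograph A S, dist_id (full_sub B T))"

definition comparison_R1 ::
  "('o, 'a) quantaloid_data \<Rightarrow> ('x, 'o, 'a) qcat \<Rightarrow> ('y, 'o, 'a) qcat \<Rightarrow> ('x \<Rightarrow> 'y \<Rightarrow> 'a)
    \<Rightarrow> 'x set \<Rightarrow> 'y set \<Rightarrow> ('x, 'o, 'a) presheaf \<Rightarrow> ('x, 'o, 'a) presheaf" where
  "comparison_R1 Q A B \<phi> S T =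
     compose (Obj (M_cat Q A B \<phi>))
       (M_incl_cod Q A B \<phi> S T)
       (right_adjoint Q (M_sub Q A B \<phi> S (Obj B)) (M_cat Q A B \<phi>)
          (M_incl_dom Q A B \<phi> S (Obj B)))"

definition comparison_R2 ::
  "('o, 'a) quantaloid_data \<Rightarrow> ('x, 'o, 'a) qcat \<Rightarrow> ('y, 'o, 'a) qcat \<Rightarrow> ('x \<Rightarrow> 'y \<Rightarrow> 'a)
    \<Rightarrow> 'x set \<Rightarrow> 'y set \<Rightarrow> ('x, 'o, 'a) presheaf \<Rightarrow> ('x, 'o, 'a) presheaf" where
  "comparison_R2 Q A B \<phi> S T =
     compose (Obj (M_cat Q A B \<phi>))
       (right_adjoint Q (M_sub Q A B \<phi> S T) (M_sub Q A B \<phi> (Obj A) T)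
          (M_incl_dom Q A B \<phi> S T))
       (M_incl_cod Q A B \<phi> (Obj A) T)"

definition comparison_E1 ::
  "('o, 'a) quantaloid_data \<Rightarrow> ('x, 'o, 'a) qcat \<Rightarrow> ('y, 'o, 'a) qcat \<Rightarrow> ('x \<Rightarrow> 'y \<Rightarrow> 'a)
    \<Rightarrow> 'x set \<Rightarrow> 'y set \<Rightarrow> ('x, 'o, 'a) presheaf \<Rightarrow> ('x, 'o, 'a) presheaf" where
  "comparison_E1 Q A B \<phi> S T =
     compose (Obj (M_sub Q A B \<phi> S T))
       (M_incl_dom Q A B \<phi> S (Obj B))
       (right_adjoint Q (M_sub Q A B \<phi> S (Obj B)) (M_sub Q A B \<phi> S T)
          (M_incl_cod Q A B \<phi> S T))"

definition comparison_E2 ::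
  "('o, 'a) quantaloid_data \<Rightarrow> ('x, 'o, 'a) qcat \<Rightarrow> ('y, 'o, 'a) qcat \<Rightarrow> ('x \<Rightarrow> 'y \<Rightarrow> 'a)
    \<Rightarrow> 'x set \<Rightarrow> 'y set \<Rightarrow> ('x, 'o, 'a) presheaf \<Rightarrow> ('x, 'o, 'a) presheaf" where
  "comparison_E2 Q A B \<phi> S T =
     compose (Obj (M_sub Q A B \<phi> S T))
       (right_adjoint Q (M_cat Q A B \<phi>) (M_sub Q A B \<phi> (Obj A) T)
          (M_incl_cod Q A B \<phi> (Obj A) T))
       (M_incl_dom Q A B \<phi> S T)"


section \<open>The comparison functors are built from Chu connections\<close>

lemma full_sub_Obj [simp]: "full_sub A (Obj A) = A"
  by (simp add: full_sub_def)

lemma full_sub_sel [simp]: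
  "Obj (full_sub A S) = S" "Typ (full_sub A S) = Typ A" "Arr (full_sub A S) = Arr A"
  by (simp_all add: full_sub_def)

lemma dist_restrict_Obj: "\<phi> \<in> Dist Q A B \<Longrightarrow> dist_restrict (Obj A) (Obj B) \<phi> = \<phi>"
  by (auto simp: Dist_def dist_restrict_def PiE_def extensional_def Pi_def restrict_def fun_eq_iff)

lemma qcategory_full_sub: "\<lbrakk>qcategory Q A; S \<subseteq> Obj A\<rbrakk> \<Longrightarrow> qcategory Q (full_sub A S)"
  unfolding qcategory_def full_sub_sel by (meson subsetD)

lemma dist_restrict_closed:
  "\<lbrakk>\<phi> \<in> Dist Q A B; S \<subseteq> Obj A; T \<subseteq> Obj B\<rbrakk>
   \<Longrightarrow> dist_restrict S T \<phi> \<in> Dist Q (full_sub A S) (full_sub B T)"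
  by (auto simp: Dist_def dist_restrict_def PiE_def Pi_def subset_iff)

context quantaloid
begin

lemma comp_mono:
  assumes X: "X \<in> Ob Q" and Y: "Y \<in> Ob Q" and Z: "Z \<in> Ob Q"
    and f: "f \<in> carrier (Hom Q X Y)" "f' \<in> carrier (Hom Q X Y)" "f \<sqsubseteq>\<^bsub>Hom Q X Y\<^esub> f'"
    and g: "g \<in> carrier (Hom Q Y Z)" "g' \<in> carrier (Hom Q Y Z)" "g \<sqsubseteq>\<^bsub>Hom Q Y Z\<^esub> g'"
  shows "Comp Q X Y Z g f \<sqsubseteq>\<^bsub>Hom Q X Z\<^esub> Comp Q X Y Z g' f'"
proof -
  interpret XY: complete_lattice "Hom Q X Y" using hom_complete_lattice X Y .
  interpret YZ: complete_lattice "Hom Q Y Z" using hom_complete_lattice Y Z .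
  interpret XZ: complete_lattice "Hom Q X Z" using hom_complete_lattice X Z .
  have sf: "\<Squnion>\<^bsub>Hom Q X Y\<^esub> {f, f'} = f'"
    using f by (intro XY.le_antisym XY.sup_least XY.sup_upper) auto
  have sg: "\<Squnion>\<^bsub>Hom Q Y Z\<^esub> {g, g'} = g'"
    using g by (intro YZ.le_antisym YZ.sup_least YZ.sup_upper) auto
  have c: "Comp Q X Y Z g f \<in> carrier (Hom Q X Z)" "Comp Q X Y Z g f' \<in> carrier (Hom Q X Z)"
    "Comp Q X Y Z g' f' \<in> carrier (Hom Q X Z)"
    using comp_closed X Y Z f g by auto
  have "Comp Q X Y Z g f' = \<Squnion>\<^bsub>Hom Q X Z\<^esub> {Comp Q X Y Z g f, Comp Q X Y Z g f'}"
    using comp_sup_right[OF X Y Z, of "{f, f'}" g] f g sf by simp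
  then have 1: "Comp Q X Y Z g f \<sqsubseteq>\<^bsub>Hom Q X Z\<^esub> Comp Q X Y Z g f'"
    using XZ.sup_upper[of "{Comp Q X Y Z g f, Comp Q X Y Z g f'}" "Comp Q X Y Z g f"] c by simp
  have "Comp Q X Y Z g' f' = \<Squnion>\<^bsub>Hom Q X Z\<^esub> {Comp Q X Y Z g f', Comp Q X Y Z g' f'}"
    using comp_sup_left[OF X Y Z, of f' "{g, g'}"] f g sg by simp
  then have 2: "Comp Q X Y Z g f' \<sqsubseteq>\<^bsub>Hom Q X Z\<^esub> Comp Q X Y Z g' f'"
    using XZ.sup_upper[of "{Comp Q X Y Z g f', Comp Q X Y Z g' f'}" "Comp Q X Y Z g f'"] c by simp
  show ?thesis using 1 2 c XZ.le_trans by blast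
qed

lemma hom_trans:
  assumes "X \<in> Ob Q" "Y \<in> Ob Q" "f \<sqsubseteq>\<^bsub>Hom Q X Y\<^esub> g" "g \<sqsubseteq>\<^bsub>Hom Q X Y\<^esub> h"
    "f \<in> carrier (Hom Q X Y)" "g \<in> carrier (Hom Q X Y)" "h \<in> carrier (Hom Q X Y)"
  shows "f \<sqsubseteq>\<^bsub>Hom Q X Y\<^esub> h"
proof -
  interpret XY: complete_lattice "Hom Q X Y" using hom_complete_lattice assms(1,2) .
  show ?thesis using assms XY.le_trans by blast
qed

lemma hom_refl:
  assumes "X \<in> Ob Q" "Y \<in> Ob Q" "f \<in> carrier (Hom Q X Y)"
  shows "f \<sqsubseteq>\<^bsub>Hom Q X Y\<^esub> f"
proof -
  interpret XY: complete_lattice "Hom Q X Y" using hom_complete_lattice assms(1,2) .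
  show ?thesis using assms by blast
qed

lemma dist_antisym:
  assumes A: "qcategory Q A" and B: "qcategory Q B"
    and "\<phi> \<in> Dist Q A B" "\<psi> \<in> Dist Q A B" "dist_le Q A B \<phi> \<psi>" "dist_le Q A B \<psi> \<phi>"
  shows "\<phi> = \<psi>"
proof -
  have "\<phi> x y = \<psi> x y" if "x \<in> Obj A" "y \<in> Obj B" for x y
  proof -
    interpret L: complete_lattice "Hom Q (Typ A x) (Typ B y)"
      using hom_complete_lattice A B that by (simp add: qcategory_def)
    show ?thesis
      using assms that by (auto simp: dist_le_def Dist_def intro!: L.le_antisym)
  qed
  moreover have "dist_restrict (Obj A) (Obj B) \<phi> = \<phi>" "dist_restrict (Obj A) (Obj B) \<psi> = \<psi>"
    using assms dist_restrict_Obj by blast+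
  ultimately show ?thesis
    by (metis (mono_tags, lifting) dist_restrict_def restrict_ext)
qed

lemma left_impl_eqI:
  assumes "qcategory Q B" "qcategory Q C" "\<chi> \<in> Dist Q B C"
    and "\<And>\<psi>. \<psi> \<in> Dist Q B C \<Longrightarrow>
           dist_le Q A C (dist_comp Q A B C \<psi> \<phi>) \<theta> \<longleftrightarrow> dist_le Q B C \<psi> \<chi>"
  shows "left_impl Q A B C \<theta> \<phi> = \<chi>"
proof -
  have refl: "dist_le Q B C \<psi> \<psi>" if "\<psi> \<in> Dist Q B C" for \<psi>
    using that assms(1,2) by (auto simp: dist_le_def Dist_def qcategory_def intro!: hom_refl)
  show ?thesis
    unfolding left_impl_def
    by (rule the_equality) (use assms refl dist_antisym in blast)+
qed

lemma right_impl_eqI: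
  assumes "qcategory Q A" "qcategory Q B" "\<chi> \<in> Dist Q A B"
    and "\<And>\<phi>. \<phi> \<in> Dist Q A B \<Longrightarrow>
           dist_le Q A C (dist_comp Q A B C \<psi> \<phi>) \<theta> \<longleftrightarrow> dist_le Q A B \<phi> \<chi>"
  shows "right_impl Q A B C \<psi> \<theta> = \<chi>"
proof -
  have refl: "dist_le Q A B \<phi> \<phi>" if "\<phi> \<in> Dist Q A B" for \<phi>
    using that assms(1,2) by (auto simp: dist_le_def Dist_def qcategory_def intro!: hom_refl)
  show ?thesis
    unfolding right_impl_def
    by (rule the_equality) (use assms refl dist_antisym in blast)+
qed

lemma dist_comp_le_iff:
  assumes A: "qcategory Q A" and B: "qcategory Q B" and C: "qcategory Q C"
    and \<phi>: "\<And>x y. \<lbrakk>x \<in> Obj A; y \<in> Obj B\<rbrakk> \<Longrightarrow> \<phi> x y \<in> carrier (Hom Q (Typ A x) (Typ B y))"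
    and \<psi>: "\<And>y z. \<lbrakk>y \<in> Obj B; z \<in> Obj C\<rbrakk> \<Longrightarrow> \<psi> y z \<in> carrier (Hom Q (Typ B y) (Typ C z))"
    and \<theta>: "\<And>x z. \<lbrakk>x \<in> Obj A; z \<in> Obj C\<rbrakk> \<Longrightarrow> \<theta> x z \<in> carrier (Hom Q (Typ A x) (Typ C z))"
  shows "dist_le Q A C (dist_comp Q A B C \<psi> \<phi>) \<theta> \<longleftrightarrow>
    (\<forall>x\<in>Obj A. \<forall>y\<in>Obj B. \<forall>z\<in>Obj C.
       Comp Q (Typ A x) (Typ B y) (Typ C z) (\<psi> y z) (\<phi> x y)
         \<sqsubseteq>\<^bsub>Hom Q (Typ A x) (Typ C z)\<^esub> \<theta> x z)"
proof -
  have "dist_comp Q A B C \<psi> \<phi> x z \<sqsubseteq>\<^bsub>Hom Q (Typ A x) (Typ C z)\<^esub> \<theta> x z \<longleftrightarrow>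
     (\<forall>y\<in>Obj B. Comp Q (Typ A x) (Typ B y) (Typ C z) (\<psi> y z) (\<phi> x y)
         \<sqsubseteq>\<^bsub>Hom Q (Typ A x) (Typ C z)\<^esub> \<theta> x z)"
    if x: "x \<in> Obj A" and z: "z \<in> Obj C" for x z
  proof -
    interpret L: complete_lattice "Hom Q (Typ A x) (Typ C z)"
      using hom_complete_lattice A C x z by (simp add: qcategory_def)
    let ?F = "(\<lambda>y. Comp Q (Typ A x) (Typ B y) (Typ C z) (\<psi> y z) (\<phi> x y)) ` Obj B"
    have sub: "?F \<subseteq> carrier (Hom Q (Typ A x) (Typ C z))"
      using A B C x z \<phi> \<psi> by (auto simp: qcategory_def intro!: comp_closed)
    have e: "dist_comp Q A B C \<psi> \<phi> x z = \<Squnion>\<^bsub>Hom Q (Typ A x) (Typ C z)\<^esub> ?F"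
      using x z by (simp add: dist_comp_def)
    show ?thesis
    proof
      assume l: "dist_comp Q A B C \<psi> \<phi> x z \<sqsubseteq>\<^bsub>Hom Q (Typ A x) (Typ C z)\<^esub> \<theta> x z"
      show "\<forall>y\<in>Obj B. Comp Q (Typ A x) (Typ B y) (Typ C z) (\<psi> y z) (\<phi> x y)
         \<sqsubseteq>\<^bsub>Hom Q (Typ A x) (Typ C z)\<^esub> \<theta> x z"
      proof
        fix y assume y: "y \<in> Obj B"
        let ?c = "Comp Q (Typ A x) (Typ B y) (Typ C z) (\<psi> y z) (\<phi> x y)"
        have m: "?c \<in> ?F" using y by blast
        show "?c \<sqsubseteq>\<^bsub>Hom Q (Typ A x) (Typ C z)\<^esub> \<theta> x z"
          using L.sup_upper[OF sub m] l \<theta>[OF x z] L.sup_closed[OF sub] sub m unfolding e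
          by (meson L.le_trans subsetD)
      qed
    next
      assume l: "\<forall>y\<in>Obj B. Comp Q (Typ A x) (Typ B y) (Typ C z) (\<psi> y z) (\<phi> x y)
         \<sqsubseteq>\<^bsub>Hom Q (Typ A x) (Typ C z)\<^esub> \<theta> x z"
      show "dist_comp Q A B C \<psi> \<phi> x z \<sqsubseteq>\<^bsub>Hom Q (Typ A x) (Typ C z)\<^esub> \<theta> x z"
        unfolding e by (rule L.sup_least[OF sub]) (use l \<theta>[OF x z] in auto)
    qed
  qed
  then show ?thesis by (auto simp: dist_le_def)
qed

lemma dist_id_closed: "qcategory Q A \<Longrightarrow> dist_id A \<in> Dist Q A A"
proof -
  assume A: "qcategory Q A"
  have "Comp Q (Typ A x') (Typ A y) (Typ A y') (Arr A y y')
          (Comp Q (Typ A x') (Typ A x) (Typ A y) (Arr A x y) (Arr A x' x))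
        \<sqsubseteq>\<^bsub>Hom Q (Typ A x') (Typ A y')\<^esub> Arr A x' y'"
    if "x \<in> Obj A" "x' \<in> Obj A" "y \<in> Obj A" "y' \<in> Obj A" for x x' y y'
  proof -
    have ob: "Typ A x \<in> Ob Q" "Typ A x' \<in> Ob Q" "Typ A y \<in> Ob Q" "Typ A y' \<in> Ob Q"
      and c: "Arr A x y \<in> carrier (Hom Q (Typ A x) (Typ A y))"
        "Arr A x' x \<in> carrier (Hom Q (Typ A x') (Typ A x))"
        "Arr A x' y \<in> carrier (Hom Q (Typ A x') (Typ A y))"
        "Arr A y y' \<in> carrier (Hom Q (Typ A y) (Typ A y'))"
        "Arr A x' y' \<in> carrier (Hom Q (Typ A x') (Typ A y'))"
      and t: "Comp Q (Typ A x') (Typ A x) (Typ A y) (Arr A x y) (Arr A x' x)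
          \<sqsubseteq>\<^bsub>Hom Q (Typ A x') (Typ A y)\<^esub> Arr A x' y"
        "Comp Q (Typ A x') (Typ A y) (Typ A y') (Arr A y y') (Arr A x' y)
          \<sqsubseteq>\<^bsub>Hom Q (Typ A x') (Typ A y')\<^esub> Arr A x' y'"
      using A that by (auto simp: qcategory_def)
    have k: "Comp Q (Typ A x') (Typ A x) (Typ A y) (Arr A x y) (Arr A x' x)
        \<in> carrier (Hom Q (Typ A x') (Typ A y))"
      using comp_closed ob c by blast
    have r: "Arr A y y' \<sqsubseteq>\<^bsub>Hom Q (Typ A y) (Typ A y')\<^esub> Arr A y y'"
      using hom_refl ob c by blast
    show ?thesis
      by (rule hom_trans[OF _ _ comp_mono[OF ob(2,3,4) k c(3) t(1) c(4,4) r] t(2)])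
         (use comp_closed ob c k in blast)+
  qed
  then show ?thesis
    using A by (auto simp: Dist_def dist_id_def qcategory_def)
qed

lemma dist_carrier:
  "\<lbrakk>\<phi> \<in> Dist Q A B; x \<in> Obj A; y \<in> Obj B\<rbrakk> \<Longrightarrow> \<phi> x y \<in> carrier (Hom Q (Typ A x) (Typ B y))"
  by (auto simp: Dist_def)

lemma dist_action_left:
  assumes A: "qcategory Q A" and B: "qcategory Q B" and \<phi>: "\<phi> \<in> Dist Q A B"
    and m: "x \<in> Obj A" "y \<in> Obj B" "y' \<in> Obj B"
  shows "Comp Q (Typ A x) (Typ B y) (Typ B y') (Arr B y y') (\<phi> x y)
           \<sqsubseteq>\<^bsub>Hom Q (Typ A x) (Typ B y')\<^esub> \<phi> x y'"
proof -
  have ob: "Typ A x \<in> Ob Q" "Typ B y \<in> Ob Q" "Typ B y' \<in> Ob Q"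
    and c: "\<phi> x y \<in> carrier (Hom Q (Typ A x) (Typ B y))"
      "\<phi> x y' \<in> carrier (Hom Q (Typ A x) (Typ B y'))"
      "Arr A x x \<in> carrier (Hom Q (Typ A x) (Typ A x))"
      "Arr B y y' \<in> carrier (Hom Q (Typ B y) (Typ B y'))"
    and u: "Ident Q (Typ A x) \<sqsubseteq>\<^bsub>Hom Q (Typ A x) (Typ A x)\<^esub> Arr A x x"
    using A B m dist_carrier[OF \<phi>] by (auto simp: qcategory_def)
  let ?g = "Comp Q (Typ A x) (Typ A x) (Typ B y) (\<phi> x y) (Arr A x x)"
  have "Comp Q (Typ A x) (Typ A x) (Typ B y) (\<phi> x y) (Ident Q (Typ A x))
          \<sqsubseteq>\<^bsub>Hom Q (Typ A x) (Typ B y)\<^esub> ?g"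
    by (rule comp_mono) (simp_all add: ob c u ident_closed hom_refl)
  then have 1: "\<phi> x y \<sqsubseteq>\<^bsub>Hom Q (Typ A x) (Typ B y)\<^esub> ?g"
    using comp_ident_right ob c by simp
  have g: "?g \<in> carrier (Hom Q (Typ A x) (Typ B y))"
    using comp_closed ob c by blast
  have 2: "Comp Q (Typ A x) (Typ B y) (Typ B y') (Arr B y y') (\<phi> x y)
           \<sqsubseteq>\<^bsub>Hom Q (Typ A x) (Typ B y')\<^esub> Comp Q (Typ A x) (Typ B y) (Typ B y') (Arr B y y') ?g"
    by (rule comp_mono) (simp_all add: ob c g 1 hom_refl)
  have 3: "Comp Q (Typ A x) (Typ B y) (Typ B y') (Arr B y y') ?g
           \<sqsubseteq>\<^bsub>Hom Q (Typ A x) (Typ B y')\<^esub> \<phi> x y'"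
    using \<phi> m unfolding Dist_def by blast
  show ?thesis
    by (rule hom_trans[OF _ _ 2 3]) (use ob c g comp_closed in auto)
qed

lemma dist_action_right:
  assumes A: "qcategory Q A" and B: "qcategory Q B" and \<phi>: "\<phi> \<in> Dist Q A B"
    and m: "x \<in> Obj A" "x' \<in> Obj A" "y \<in> Obj B"
  shows "Comp Q (Typ A x') (Typ A x) (Typ B y) (\<phi> x y) (Arr A x' x)
           \<sqsubseteq>\<^bsub>Hom Q (Typ A x') (Typ B y)\<^esub> \<phi> x' y"
proof -
  have ob: "Typ A x \<in> Ob Q" "Typ A x' \<in> Ob Q" "Typ B y \<in> Ob Q"
    and c: "\<phi> x y \<in> carrier (Hom Q (Typ A x) (Typ B y))"
      "\<phi> x' y \<in> carrier (Hom Q (Typ A x') (Typ B y))"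
      "Arr A x' x \<in> carrier (Hom Q (Typ A x') (Typ A x))"
      "Arr B y y \<in> carrier (Hom Q (Typ B y) (Typ B y))"
    and u: "Ident Q (Typ B y) \<sqsubseteq>\<^bsub>Hom Q (Typ B y) (Typ B y)\<^esub> Arr B y y"
    using A B m dist_carrier[OF \<phi>] by (auto simp: qcategory_def)
  let ?g = "Comp Q (Typ A x') (Typ A x) (Typ B y) (\<phi> x y) (Arr A x' x)"
  have g: "?g \<in> carrier (Hom Q (Typ A x') (Typ B y))"
    using comp_closed ob c by blast
  have "Comp Q (Typ A x') (Typ B y) (Typ B y) (Ident Q (Typ B y)) ?g
          \<sqsubseteq>\<^bsub>Hom Q (Typ A x') (Typ B y)\<^esub> Comp Q (Typ A x') (Typ B y) (Typ B y) (Arr B y y) ?g"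
    by (rule comp_mono) (simp_all add: ob c g u ident_closed hom_refl)
  then have 2: "?g \<sqsubseteq>\<^bsub>Hom Q (Typ A x') (Typ B y)\<^esub>
      Comp Q (Typ A x') (Typ B y) (Typ B y) (Arr B y y) ?g"
    using comp_ident_left ob g by simp
  have 3: "Comp Q (Typ A x') (Typ B y) (Typ B y) (Arr B y y) ?g
           \<sqsubseteq>\<^bsub>Hom Q (Typ A x') (Typ B y)\<^esub> \<phi> x' y"
    using \<phi> m unfolding Dist_def by blast
  show ?thesis
    by (rule hom_trans[OF _ _ 2 3]) (use ob c g comp_closed in auto)
qed

lemma left_impl_incl:
  assumes A: "qcategory Q A" and B: "qcategory Q B" and \<phi>: "\<phi> \<in> Dist Q A B" and S: "S \<subseteq> Obj A"
  shows "left_impl Q A (full_sub A S) B \<phi> (incl_cograph A S) = dist_restrict S (Obj B) \<phi>"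
proof (rule left_impl_eqI)
  show A': "qcategory Q (full_sub A S)" using A S by (rule qcategory_full_sub)
  show "qcategory Q B" by (rule B)
  show r: "dist_restrict S (Obj B) \<phi> \<in> Dist Q (full_sub A S) B"
    using dist_restrict_closed[OF \<phi> S subset_refl] by simp
  fix \<psi> assume \<psi>: "\<psi> \<in> Dist Q (full_sub A S) B"
  note m = subsetD[OF S]
  have "dist_le Q A B (dist_comp Q A (full_sub A S) B \<psi> (incl_cograph A S)) \<phi> \<longleftrightarrow>
    (\<forall>x\<in>Obj A. \<forall>y\<in>S. \<forall>z\<in>Obj B.
       Comp Q (Typ A x) (Typ A y) (Typ B z) (\<psi> y z) (Arr A x y)
         \<sqsubseteq>\<^bsub>Hom Q (Typ A x) (Typ B z)\<^esub> \<phi> x z)"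
    by (subst dist_comp_le_iff[OF A A' B])
       (use A m dist_carrier[OF \<phi>] dist_carrier[OF \<psi>] in
        \<open>auto simp: qcategory_def incl_cograph_def cograph_def functor_id_def\<close>)
  also have "\<dots> \<longleftrightarrow> dist_le Q (full_sub A S) B \<psi> (dist_restrict S (Obj B) \<phi>)"
  proof
    assume h: "\<forall>x\<in>Obj A. \<forall>y\<in>S. \<forall>z\<in>Obj B.
       Comp Q (Typ A x) (Typ A y) (Typ B z) (\<psi> y z) (Arr A x y)
         \<sqsubseteq>\<^bsub>Hom Q (Typ A x) (Typ B z)\<^esub> \<phi> x z"
    have "\<psi> y z \<sqsubseteq>\<^bsub>Hom Q (Typ A y) (Typ B z)\<^esub> \<phi> y z" if yz: "y \<in> S" "z \<in> Obj B" for y z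
    proof -
      have ob: "Typ A y \<in> Ob Q" "Typ B z \<in> Ob Q"
        and c: "\<psi> y z \<in> carrier (Hom Q (Typ A y) (Typ B z))"
          "\<phi> y z \<in> carrier (Hom Q (Typ A y) (Typ B z))"
          "Arr A y y \<in> carrier (Hom Q (Typ A y) (Typ A y))"
        and u: "Ident Q (Typ A y) \<sqsubseteq>\<^bsub>Hom Q (Typ A y) (Typ A y)\<^esub> Arr A y y"
        using A B m yz dist_carrier[OF \<phi>] dist_carrier[OF \<psi>] by (auto simp: qcategory_def)
      have "Comp Q (Typ A y) (Typ A y) (Typ B z) (\<psi> y z) (Ident Q (Typ A y))
         \<sqsubseteq>\<^bsub>Hom Q (Typ A y) (Typ B z)\<^esub> Comp Q (Typ A y) (Typ A y) (Typ B z) (\<psi> y z) (Arr A y y)"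
        by (rule comp_mono) (simp_all add: ob c u ident_closed hom_refl)
      then have 1: "\<psi> y z \<sqsubseteq>\<^bsub>Hom Q (Typ A y) (Typ B z)\<^esub>
          Comp Q (Typ A y) (Typ A y) (Typ B z) (\<psi> y z) (Arr A y y)"
        using comp_ident_right ob c by simp
      show ?thesis
        by (rule hom_trans[OF _ _ 1]) (use h ob c comp_closed m yz in auto)
    qed
    then show "dist_le Q (full_sub A S) B \<psi> (dist_restrict S (Obj B) \<phi>)"
      by (simp add: dist_le_def dist_restrict_def)
  next
    assume h: "dist_le Q (full_sub A S) B \<psi> (dist_restrict S (Obj B) \<phi>)"
    show "\<forall>x\<in>Obj A. \<forall>y\<in>S. \<forall>z\<in>Obj B.
       Comp Q (Typ A x) (Typ A y) (Typ B z) (\<psi> y z) (Arr A x y)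
         \<sqsubseteq>\<^bsub>Hom Q (Typ A x) (Typ B z)\<^esub> \<phi> x z"
    proof (intro ballI)
      fix x y z assume xyz: "x \<in> Obj A" "y \<in> S" "z \<in> Obj B"
      have le: "\<psi> y z \<sqsubseteq>\<^bsub>Hom Q (Typ A y) (Typ B z)\<^esub> \<phi> y z"
        using h xyz by (simp add: dist_le_def dist_restrict_def)
      have ob: "Typ A x \<in> Ob Q" "Typ A y \<in> Ob Q" "Typ B z \<in> Ob Q"
        and c: "\<psi> y z \<in> carrier (Hom Q (Typ A y) (Typ B z))"
          "\<phi> y z \<in> carrier (Hom Q (Typ A y) (Typ B z))"
          "\<phi> x z \<in> carrier (Hom Q (Typ A x) (Typ B z))"
          "Arr A x y \<in> carrier (Hom Q (Typ A x) (Typ A y))"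
        using A B m xyz dist_carrier[OF \<phi>] dist_carrier[OF \<psi>] by (auto simp: qcategory_def)
      have 1: "Comp Q (Typ A x) (Typ A y) (Typ B z) (\<psi> y z) (Arr A x y)
         \<sqsubseteq>\<^bsub>Hom Q (Typ A x) (Typ B z)\<^esub> Comp Q (Typ A x) (Typ A y) (Typ B z) (\<phi> y z) (Arr A x y)"
        by (rule comp_mono) (simp_all add: ob c le hom_refl)
      show "Comp Q (Typ A x) (Typ A y) (Typ B z) (\<psi> y z) (Arr A x y)
         \<sqsubseteq>\<^bsub>Hom Q (Typ A x) (Typ B z)\<^esub> \<phi> x z"
        by (rule hom_trans[OF _ _ 1 dist_action_right[OF A B \<phi>]])
           (use ob c comp_closed m xyz in auto)
    qed
  qed
  finally show "dist_le Q A B (dist_comp Q A (full_sub A S) B \<psi> (incl_cograph A S)) \<phi> \<longleftrightarrow>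
    dist_le Q (full_sub A S) B \<psi> (dist_restrict S (Obj B) \<phi>)" .
qed

lemma right_impl_incl:
  assumes A: "qcategory Q A" and B: "qcategory Q B" and \<phi>: "\<phi> \<in> Dist Q A B" and T: "T \<subseteq> Obj B"
  shows "right_impl Q A (full_sub B T) B (incl_graph B T) \<phi> = dist_restrict (Obj A) T \<phi>"
proof (rule right_impl_eqI)
  show B': "qcategory Q (full_sub B T)" using B T by (rule qcategory_full_sub)
  show "qcategory Q A" by (rule A)
  show r: "dist_restrict (Obj A) T \<phi> \<in> Dist Q A (full_sub B T)"
    using dist_restrict_closed[OF \<phi> subset_refl T] by simp
  fix \<psi> assume \<psi>: "\<psi> \<in> Dist Q A (full_sub B T)"
  note m = subsetD[OF T]
  have "dist_le Q A B (dist_comp Q A (full_sub B T) B (incl_graph B T) \<psi>) \<phi> \<longleftrightarrow>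
    (\<forall>x\<in>Obj A. \<forall>y\<in>T. \<forall>z\<in>Obj B.
       Comp Q (Typ A x) (Typ B y) (Typ B z) (Arr B y z) (\<psi> x y)
         \<sqsubseteq>\<^bsub>Hom Q (Typ A x) (Typ B z)\<^esub> \<phi> x z)"
    by (subst dist_comp_le_iff[OF A B' B])
       (use B m dist_carrier[OF \<phi>] dist_carrier[OF \<psi>] in
        \<open>auto simp: qcategory_def incl_graph_def graph_def functor_id_def\<close>)
  also have "\<dots> \<longleftrightarrow> dist_le Q A (full_sub B T) \<psi> (dist_restrict (Obj A) T \<phi>)"
  proof
    assume h: "\<forall>x\<in>Obj A. \<forall>y\<in>T. \<forall>z\<in>Obj B.
       Comp Q (Typ A x) (Typ B y) (Typ B z) (Arr B y z) (\<psi> x y)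
         \<sqsubseteq>\<^bsub>Hom Q (Typ A x) (Typ B z)\<^esub> \<phi> x z"
    have "\<psi> x y \<sqsubseteq>\<^bsub>Hom Q (Typ A x) (Typ B y)\<^esub> \<phi> x y" if xy: "x \<in> Obj A" "y \<in> T" for x y
    proof -
      have ob: "Typ A x \<in> Ob Q" "Typ B y \<in> Ob Q"
        and c: "\<psi> x y \<in> carrier (Hom Q (Typ A x) (Typ B y))"
          "\<phi> x y \<in> carrier (Hom Q (Typ A x) (Typ B y))"
          "Arr B y y \<in> carrier (Hom Q (Typ B y) (Typ B y))"
        and u: "Ident Q (Typ B y) \<sqsubseteq>\<^bsub>Hom Q (Typ B y) (Typ B y)\<^esub> Arr B y y"
        using A B m xy dist_carrier[OF \<phi>] dist_carrier[OF \<psi>] by (auto simp: qcategory_def)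
      have "Comp Q (Typ A x) (Typ B y) (Typ B y) (Ident Q (Typ B y)) (\<psi> x y)
         \<sqsubseteq>\<^bsub>Hom Q (Typ A x) (Typ B y)\<^esub> Comp Q (Typ A x) (Typ B y) (Typ B y) (Arr B y y) (\<psi> x y)"
        by (rule comp_mono) (simp_all add: ob c u ident_closed hom_refl)
      then have 1: "\<psi> x y \<sqsubseteq>\<^bsub>Hom Q (Typ A x) (Typ B y)\<^esub>
          Comp Q (Typ A x) (Typ B y) (Typ B y) (Arr B y y) (\<psi> x y)"
        using comp_ident_left ob c by simp
      show ?thesis
        by (rule hom_trans[OF _ _ 1]) (use h ob c comp_closed m xy in auto)
    qed
    then show "dist_le Q A (full_sub B T) \<psi> (dist_restrict (Obj A) T \<phi>)"
      by (simp add: dist_le_def dist_restrict_def)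
  next
    assume h: "dist_le Q A (full_sub B T) \<psi> (dist_restrict (Obj A) T \<phi>)"
    show "\<forall>x\<in>Obj A. \<forall>y\<in>T. \<forall>z\<in>Obj B.
       Comp Q (Typ A x) (Typ B y) (Typ B z) (Arr B y z) (\<psi> x y)
         \<sqsubseteq>\<^bsub>Hom Q (Typ A x) (Typ B z)\<^esub> \<phi> x z"
    proof (intro ballI)
      fix x y z assume xyz: "x \<in> Obj A" "y \<in> T" "z \<in> Obj B"
      have le: "\<psi> x y \<sqsubseteq>\<^bsub>Hom Q (Typ A x) (Typ B y)\<^esub> \<phi> x y"
        using h xyz by (simp add: dist_le_def dist_restrict_def)
      have ob: "Typ A x \<in> Ob Q" "Typ B y \<in> Ob Q" "Typ B z \<in> Ob Q"
        and c: "\<psi> x y \<in> carrier (Hom Q (Typ A x) (Typ B y))"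
          "\<phi> x y \<in> carrier (Hom Q (Typ A x) (Typ B y))"
          "\<phi> x z \<in> carrier (Hom Q (Typ A x) (Typ B z))"
          "Arr B y z \<in> carrier (Hom Q (Typ B y) (Typ B z))"
        using A B m xyz dist_carrier[OF \<phi>] dist_carrier[OF \<psi>] by (auto simp: qcategory_def)
      have 1: "Comp Q (Typ A x) (Typ B y) (Typ B z) (Arr B y z) (\<psi> x y)
         \<sqsubseteq>\<^bsub>Hom Q (Typ A x) (Typ B z)\<^esub> Comp Q (Typ A x) (Typ B y) (Typ B z) (Arr B y z) (\<phi> x y)"
        by (rule comp_mono) (simp_all add: ob c le hom_refl)
      show "Comp Q (Typ A x) (Typ B y) (Typ B z) (Arr B y z) (\<psi> x y)
         \<sqsubseteq>\<^bsub>Hom Q (Typ A x) (Typ B z)\<^esub> \<phi> x z"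
        by (rule hom_trans[OF _ _ 1 dist_action_left[OF A B \<phi>]])
           (use ob c comp_closed m xyz in auto)
    qed
  qed
  finally show "dist_le Q A B (dist_comp Q A (full_sub B T) B (incl_graph B T) \<psi>) \<phi> \<longleftrightarrow>
    dist_le Q A (full_sub B T) \<psi> (dist_restrict (Obj A) T \<phi>)" .
qed

lemma incl_eq_dist_id: "incl_graph A (Obj A) = dist_id A" "incl_cograph A (Obj A) = dist_id A"
  by (auto simp: incl_graph_def incl_cograph_def graph_def cograph_def functor_id_def dist_id_def
           intro!: restrict_ext)

lemma incl_graph_closed:
  assumes "qcategory Q B" "T \<subseteq> Obj B"
  shows "incl_graph B T \<in> Dist Q (full_sub B T) B"
proof -
  have "incl_graph B T = dist_restrict T (Obj B) (dist_id B)"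
    using assms(2) by (auto simp: incl_graph_def graph_def functor_id_def dist_id_def
        dist_restrict_def intro!: restrict_ext)
  then show ?thesis
    using dist_restrict_closed[OF dist_id_closed[OF assms(1)] assms(2) subset_refl] by simp
qed

lemma incl_cograph_closed:
  assumes "qcategory Q A" "S \<subseteq> Obj A"
  shows "incl_cograph A S \<in> Dist Q A (full_sub A S)"
proof -
  have "incl_cograph A S = dist_restrict (Obj A) S (dist_id A)"
    using assms(2) by (auto simp: incl_cograph_def cograph_def functor_id_def dist_id_def
        dist_restrict_def intro!: restrict_ext)
  then show ?thesis
    using dist_restrict_closed[OF dist_id_closed[OF assms(1)] subset_refl assms(2)] by simp
qed

lemma chu_connection_incl_cod:
  assumes A: "qcategory Q A" and B: "qcategory Q B" and \<phi>: "\<phi> \<in> Dist Q A B"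
    and S: "S \<subseteq> Obj A" and T: "T \<subseteq> Obj B"
  shows "chu_connection Q (full_sub A S) (full_sub B T) (dist_restrict S T \<phi>)
           (full_sub A S) B (dist_restrict S (Obj B) \<phi>)
           (dist_id (full_sub A S), incl_graph B T)"
proof -
  let ?A = "full_sub A S" and ?B = "full_sub B T"
  have A': "qcategory Q ?A" and B': "qcategory Q ?B"
    using A B S T qcategory_full_sub by blast+
  have d: "dist_restrict S (Obj B) \<phi> \<in> Dist Q ?A B" "dist_restrict S T \<phi> \<in> Dist Q ?A ?B"
    using dist_restrict_closed[OF \<phi> S] T by (metis full_sub_Obj subset_refl)+
  have "left_impl Q ?A ?A ?B (dist_restrict S T \<phi>) (dist_id ?A) = dist_restrict S T \<phi>"
    using left_impl_incl[OF A' B' d(2) subset_refl] dist_restrict_Obj[OF d(2)]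
    unfolding full_sub_Obj incl_eq_dist_id by simp
  moreover have "right_impl Q ?A ?B B (incl_graph B T) (dist_restrict S (Obj B) \<phi>)
      = dist_restrict S T (dist_restrict S (Obj B) \<phi>)"
    using right_impl_incl[OF A' B d(1) T] by simp
  moreover have "dist_restrict S T (dist_restrict S (Obj B) \<phi>) = dist_restrict S T \<phi>"
    using T by (auto simp: dist_restrict_def intro!: restrict_ext)
  ultimately show ?thesis
    using dist_id_closed[OF A'] incl_graph_closed[OF B T] by (simp add: chu_connection_def)
qed

lemma chu_connection_incl_dom:
  assumes A: "qcategory Q A" and B: "qcategory Q B" and \<phi>: "\<phi> \<in> Dist Q A B"
    and S: "S \<subseteq> Obj A" and T: "T \<subseteq> Obj B"
  shows "chu_connection Q A (full_sub B T) (dist_restrict (Obj A) T \<phi>)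
           (full_sub A S) (full_sub B T) (dist_restrict S T \<phi>)
           (incl_cograph A S, dist_id (full_sub B T))"
proof -
  let ?A = "full_sub A S" and ?B = "full_sub B T"
  have A': "qcategory Q ?A" and B': "qcategory Q ?B"
    using A B S T qcategory_full_sub by blast+
  have d: "dist_restrict (Obj A) T \<phi> \<in> Dist Q A ?B" "dist_restrict S T \<phi> \<in> Dist Q ?A ?B"
    using dist_restrict_closed[OF \<phi> _ T] S by (metis full_sub_Obj subset_refl)+
  have "right_impl Q ?A ?B ?B (dist_id ?B) (dist_restrict S T \<phi>) = dist_restrict S T \<phi>"
    using right_impl_incl[OF A' B' d(2) subset_refl] dist_restrict_Obj[OF d(2)]
    unfolding full_sub_Obj incl_eq_dist_id by simp
  moreover have "left_impl Q A ?A ?B (dist_restrict (Obj A) T \<phi>) (incl_cograph A S)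
      = dist_restrict S T (dist_restrict (Obj A) T \<phi>)"
    using left_impl_incl[OF A B' d(1) S] by simp
  moreover have "dist_restrict S T (dist_restrict (Obj A) T \<phi>) = dist_restrict S T \<phi>"
    using S by (auto simp: dist_restrict_def intro!: restrict_ext)
  ultimately show ?thesis
    using dist_id_closed[OF B'] incl_cograph_closed[OF A S] by (simp add: chu_connection_def)
qed

end

end

theory Submission
  imports Defs
begin

text \<open>
  For a Chu connection \<open>(\<zeta>, \<eta>) : \<phi> \<rightarrow> \<psi>\<close> the functor \<open>M(\<zeta>, \<eta>) : M \<psi> \<rightarrow> M \<phi>\<close> is left adjoint
  to \<open>\<mu> \<mapsto> \<mu> \<swarrow> \<zeta>\<close> (lemma \<open>M_map_adjunction\<close>).  For the inclusion \<open>I\<close> of \<open>A'\<close> in \<open>A\<close> and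
  \<open>\<zeta> = I\<^sup>\<natural>\<close>, this right adjoint is the restriction of presheaves from \<open>A\<close> to \<open>A'\<close>, and
  restricting to \<open>A'\<close> undoes the left adjoint (lemma \<open>M_incl_dom_adjunction\<close>).  For the
  inclusion \<open>J\<close> of \<open>B'\<close> in \<open>B\<close> the distributor \<open>\<zeta>\<close> is an identity, so the right adjoint is an
  inclusion of sets of concepts, and the left adjoint fixes the concepts that already belong
  to the smaller set (lemma \<open>M_incl_cod\<close>).

  The four right adjoints form a square: from \<open>M \<phi>\<^bsub>A,B'\<^esub>\<close> one may include into \<open>M \<phi>\<close> and
  then restrict to \<open>M \<phi>\<^bsub>A',B\<^esub>\<close>, or restrict to \<open>M \<phi>\<^bsub>A',B'\<^esub>\<close> and then include into
  \<open>M \<phi>\<^bsub>A',B\<^esub>\<close>.  With the explicit descriptions it plainly commutes.  The left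
  adjoint of each restriction is a right inverse of it, and the left adjoint of each inclusion
  is a left inverse.  Two things follow.

  First, \<open>R\<^sub>1\<close> is a restriction followed by a retraction of an inclusion, and \<open>E\<^sub>1\<close> composes
  the two splittings in the opposite order, so \<open>R\<^sub>1 \<circ> E\<^sub>1\<close> is the identity; likewise
  \<open>R\<^sub>2 \<circ> E\<^sub>2\<close>.  Hence \<open>R\<^sub>i\<close> and \<open>E\<^sub>i\<close> are isomorphisms together, namely exactly when \<open>R\<^sub>i\<close> is
  injective (lemma \<open>qisomorphism_retraction_iff\<close>).

  Secondly, \<open>R\<^sub>1\<close> is injective exactly when \<open>R\<^sub>2\<close> is (lemma \<open>retract_square_inj_on_iff\<close>).
  If \<open>R\<^sub>1\<close> is injective, then so is the restriction \<open>M \<phi> \<rightarrow> M \<phi>\<^bsub>A',B\<^esub>\<close>, and as this is onto,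
  the reflection of \<open>M \<phi>\<^bsub>A',B\<^esub>\<close> onto \<open>M \<phi>\<^bsub>A',B'\<^esub>\<close> is injective too; both are therefore
  invertible, and chasing the commuting square gives \<open>R\<^sub>2 = R\<^sub>1\<close>.  The converse is the same
  chase from the opposite corner.
\<close>

section \<open>Residuation in a quantaloid\<close>

context quantaloid
begin

lemma Typ_Ob: "\<lbrakk>qcategory Q A; x \<in> Obj A\<rbrakk> \<Longrightarrow> Typ A x \<in> Ob Q"
  by (simp add: qcategory_def)

lemma Arr_carrier:
  "\<lbrakk>qcategory Q A; x \<in> Obj A; y \<in> Obj A\<rbrakk> \<Longrightarrow> Arr A x y \<in> carrier (Hom Q (Typ A x) (Typ A y))"
  by (simp add: qcategory_def)

lemma hom_sup_closed:
  assumes "X \<in> Ob Q" "Y \<in> Ob Q" "F \<subseteq> carrier (Hom Q X Y)"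
  shows "\<Squnion>\<^bsub>Hom Q X Y\<^esub> F \<in> carrier (Hom Q X Y)"
proof -
  interpret L: complete_lattice "Hom Q X Y" using hom_complete_lattice assms(1,2) .
  show ?thesis using assms by (intro L.sup_closed)
qed

lemma hom_sup_le_iff:
  assumes "X \<in> Ob Q" "Y \<in> Ob Q" "F \<subseteq> carrier (Hom Q X Y)" "t \<in> carrier (Hom Q X Y)"
  shows "\<Squnion>\<^bsub>Hom Q X Y\<^esub> F \<sqsubseteq>\<^bsub>Hom Q X Y\<^esub> t \<longleftrightarrow> (\<forall>f\<in>F. f \<sqsubseteq>\<^bsub>Hom Q X Y\<^esub> t)"
proof -
  interpret L: complete_lattice "Hom Q X Y" using hom_complete_lattice assms(1,2) .
  show ?thesis
  proof
    assume l: "\<Squnion>\<^bsub>Hom Q X Y\<^esub> F \<sqsubseteq>\<^bsub>Hom Q X Y\<^esub> t"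
    show "\<forall>f\<in>F. f \<sqsubseteq>\<^bsub>Hom Q X Y\<^esub> t"
    proof
      fix f assume f: "f \<in> F"
      show "f \<sqsubseteq>\<^bsub>Hom Q X Y\<^esub> t"
        by (rule L.le_trans[OF L.sup_upper[OF assms(3) f] l])
          (use assms f hom_sup_closed in auto)
    qed
  next
    assume "\<forall>f\<in>F. f \<sqsubseteq>\<^bsub>Hom Q X Y\<^esub> t"
    then show "\<Squnion>\<^bsub>Hom Q X Y\<^esub> F \<sqsubseteq>\<^bsub>Hom Q X Y\<^esub> t"
      using assms(3,4) by (intro L.sup_least) auto
  qed
qed

lemma comp_sup_right_le_iff:
  assumes "X \<in> Ob Q" "Y \<in> Ob Q" "Z \<in> Ob Q"
    "F \<subseteq> carrier (Hom Q X Y)" "g \<in> carrier (Hom Q Y Z)" "t \<in> carrier (Hom Q X Z)"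
  shows "Comp Q X Y Z g (\<Squnion>\<^bsub>Hom Q X Y\<^esub> F) \<sqsubseteq>\<^bsub>Hom Q X Z\<^esub> t \<longleftrightarrow>
         (\<forall>f\<in>F. Comp Q X Y Z g f \<sqsubseteq>\<^bsub>Hom Q X Z\<^esub> t)"
proof -
  have "(\<lambda>f. Comp Q X Y Z g f) ` F \<subseteq> carrier (Hom Q X Z)"
    using assms comp_closed by blast
  then show ?thesis
    using assms by (simp add: comp_sup_right hom_sup_le_iff)
qed

lemma comp_sup_left_le_iff:
  assumes "X \<in> Ob Q" "Y \<in> Ob Q" "Z \<in> Ob Q"
    "f \<in> carrier (Hom Q X Y)" "G \<subseteq> carrier (Hom Q Y Z)" "t \<in> carrier (Hom Q X Z)"
  shows "Comp Q X Y Z (\<Squnion>\<^bsub>Hom Q Y Z\<^esub> G) f \<sqsubseteq>\<^bsub>Hom Q X Z\<^esub> t \<longleftrightarrow>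
         (\<forall>g\<in>G. Comp Q X Y Z g f \<sqsubseteq>\<^bsub>Hom Q X Z\<^esub> t)"
proof -
  have "(\<lambda>g. Comp Q X Y Z g f) ` G \<subseteq> carrier (Hom Q X Z)"
    using assms comp_closed by blast
  then show ?thesis
    using assms by (simp add: comp_sup_left hom_sup_le_iff)
qed

text \<open>
  Precomposition preserves joins, so the join of all \<open>h\<close> with \<open>h \<circ> f i \<le> k i\<close> for every \<open>i\<close>
  still has this property.  Taking a whole family at once gives an entry of a left
  implication of distributors directly.
\<close>

lemma left_residual_exists:
  assumes Y: "Y \<in> Ob Q" and Z: "Z \<in> Ob Q"
    and X: "\<And>i. i \<in> I \<Longrightarrow> X i \<in> Ob Q"
    and f: "\<And>i. i \<in> I \<Longrightarrow> f i \<in> carrier (Hom Q (X i) Y)"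
    and k: "\<And>i. i \<in> I \<Longrightarrow> k i \<in> carrier (Hom Q (X i) Z)"
  shows "\<exists>r\<in>carrier (Hom Q Y Z). \<forall>h\<in>carrier (Hom Q Y Z).
           h \<sqsubseteq>\<^bsub>Hom Q Y Z\<^esub> r \<longleftrightarrow> (\<forall>i\<in>I. Comp Q (X i) Y Z h (f i) \<sqsubseteq>\<^bsub>Hom Q (X i) Z\<^esub> k i)"
proof -
  define H where "H = {h \<in> carrier (Hom Q Y Z).
    \<forall>i\<in>I. Comp Q (X i) Y Z h (f i) \<sqsubseteq>\<^bsub>Hom Q (X i) Z\<^esub> k i}"
  let ?r = "\<Squnion>\<^bsub>Hom Q Y Z\<^esub> H"
  have H: "H \<subseteq> carrier (Hom Q Y Z)" by (auto simp: H_def)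
  have r: "?r \<in> carrier (Hom Q Y Z)" using Y Z H by (rule hom_sup_closed)
  have up: "h \<sqsubseteq>\<^bsub>Hom Q Y Z\<^esub> ?r" if "h \<in> H" for h
    using hom_sup_le_iff[OF Y Z H r] hom_refl[OF Y Z r] that by blast
  have rk: "Comp Q (X i) Y Z ?r (f i) \<sqsubseteq>\<^bsub>Hom Q (X i) Z\<^esub> k i" if i: "i \<in> I" for i
    using comp_sup_left_le_iff[OF X[OF i] Y Z f[OF i] H k[OF i]] i by (auto simp: H_def)
  have "Comp Q (X i) Y Z h (f i) \<sqsubseteq>\<^bsub>Hom Q (X i) Z\<^esub> k i"
    if h: "h \<in> carrier (Hom Q Y Z)" "h \<sqsubseteq>\<^bsub>Hom Q Y Z\<^esub> ?r" and i: "i \<in> I" for h i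
  proof -
    have "Comp Q (X i) Y Z h (f i) \<sqsubseteq>\<^bsub>Hom Q (X i) Z\<^esub> Comp Q (X i) Y Z ?r (f i)"
      using X Y Z f h r i by (intro comp_mono hom_refl)
    then show ?thesis
      using rk[OF i] X Y Z f k h r i by (rule_tac hom_trans) (auto intro: comp_closed)
  qed
  then show ?thesis
    using r up by (intro bexI[of _ ?r]) (auto simp: H_def)
qed

lemma right_residual_exists:
  assumes X: "X \<in> Ob Q" and Y: "Y \<in> Ob Q"
    and Z: "\<And>i. i \<in> I \<Longrightarrow> Z i \<in> Ob Q"
    and g: "\<And>i. i \<in> I \<Longrightarrow> g i \<in> carrier (Hom Q Y (Z i))"
    and k: "\<And>i. i \<in> I \<Longrightarrow> k i \<in> carrier (Hom Q X (Z i))"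
  shows "\<exists>r\<in>carrier (Hom Q X Y). \<forall>h\<in>carrier (Hom Q X Y).
           h \<sqsubseteq>\<^bsub>Hom Q X Y\<^esub> r \<longleftrightarrow> (\<forall>i\<in>I. Comp Q X Y (Z i) (g i) h \<sqsubseteq>\<^bsub>Hom Q X (Z i)\<^esub> k i)"
proof -
  define H where "H = {h \<in> carrier (Hom Q X Y).
    \<forall>i\<in>I. Comp Q X Y (Z i) (g i) h \<sqsubseteq>\<^bsub>Hom Q X (Z i)\<^esub> k i}"
  let ?r = "\<Squnion>\<^bsub>Hom Q X Y\<^esub> H"
  have H: "H \<subseteq> carrier (Hom Q X Y)" by (auto simp: H_def)
  have r: "?r \<in> carrier (Hom Q X Y)" using X Y H by (rule hom_sup_closed)
  have up: "h \<sqsubseteq>\<^bsub>Hom Q X Y\<^esub> ?r" if "h \<in> H" for h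
    using hom_sup_le_iff[OF X Y H r] hom_refl[OF X Y r] that by blast
  have rk: "Comp Q X Y (Z i) (g i) ?r \<sqsubseteq>\<^bsub>Hom Q X (Z i)\<^esub> k i" if i: "i \<in> I" for i
    using comp_sup_right_le_iff[OF X Y Z[OF i] H g[OF i] k[OF i]] i by (auto simp: H_def)
  have "Comp Q X Y (Z i) (g i) h \<sqsubseteq>\<^bsub>Hom Q X (Z i)\<^esub> k i"
    if h: "h \<in> carrier (Hom Q X Y)" "h \<sqsubseteq>\<^bsub>Hom Q X Y\<^esub> ?r" and i: "i \<in> I" for h i
  proof -
    have "Comp Q X Y (Z i) (g i) h \<sqsubseteq>\<^bsub>Hom Q X (Z i)\<^esub> Comp Q X Y (Z i) (g i) ?r"
      using X Y Z g h r i by (intro comp_mono hom_refl)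
    then show ?thesis
      using rk[OF i] X Y Z g k h r i by (rule_tac hom_trans) (auto intro: comp_closed)
  qed
  then show ?thesis
    using r up by (intro bexI[of _ ?r]) (auto simp: H_def)
qed


section \<open>The calculus of distributors\<close>

lemma dist_le_refl:
  "\<lbrakk>qcategory Q A; qcategory Q B; \<phi> \<in> Dist Q A B\<rbrakk> \<Longrightarrow> dist_le Q A B \<phi> \<phi>"
  by (auto simp: dist_le_def intro!: hom_refl Typ_Ob dist_carrier)

lemma dist_eqI:
  assumes A: "qcategory Q A" and B: "qcategory Q B"
    and \<phi>: "\<phi> \<in> Dist Q A B" and \<psi>: "\<psi> \<in> Dist Q A B"
    and le: "\<And>\<chi>. \<chi> \<in> Dist Q A B \<Longrightarrow> dist_le Q A B \<chi> \<phi> \<longleftrightarrow> dist_le Q A B \<chi> \<psi>"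
  shows "\<phi> = \<psi>"
  using dist_antisym[OF A B \<phi> \<psi>] le[OF \<phi>] le[OF \<psi>] dist_le_refl[OF A B] \<phi> \<psi> by blast

lemma comp_dist_comp_le_iff:
  assumes A: "qcategory Q A" and B: "qcategory Q B" and C: "qcategory Q C"
    and \<phi>: "\<phi> \<in> Dist Q A B" and \<psi>: "\<psi> \<in> Dist Q B C"
    and x: "x \<in> Obj A" and z: "z \<in> Obj C" and W: "W \<in> Ob Q"
    and h: "h \<in> carrier (Hom Q (Typ C z) W)" and t: "t \<in> carrier (Hom Q (Typ A x) W)"
  shows "Comp Q (Typ A x) (Typ C z) W h (dist_comp Q A B C \<psi> \<phi> x z)
           \<sqsubseteq>\<^bsub>Hom Q (Typ A x) W\<^esub> t \<longleftrightarrow>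
         (\<forall>y\<in>Obj B. Comp Q (Typ A x) (Typ C z) W h
            (Comp Q (Typ A x) (Typ B y) (Typ C z) (\<psi> y z) (\<phi> x y)) \<sqsubseteq>\<^bsub>Hom Q (Typ A x) W\<^esub> t)"
proof -
  have "(\<lambda>y. Comp Q (Typ A x) (Typ B y) (Typ C z) (\<psi> y z) (\<phi> x y)) ` Obj B
          \<subseteq> carrier (Hom Q (Typ A x) (Typ C z))"
    using x z by (auto intro!: comp_closed Typ_Ob[OF A] Typ_Ob[OF B] Typ_Ob[OF C]
        dist_carrier[OF \<phi>] dist_carrier[OF \<psi>])
  from comp_sup_right_le_iff[OF Typ_Ob[OF A x] Typ_Ob[OF C z] W this h t]
  show ?thesis using x z by (simp add: dist_comp_def)
qed

lemma dist_comp_comp_le_iff: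
  assumes A: "qcategory Q A" and B: "qcategory Q B" and C: "qcategory Q C"
    and \<phi>: "\<phi> \<in> Dist Q A B" and \<psi>: "\<psi> \<in> Dist Q B C"
    and x: "x \<in> Obj A" and z: "z \<in> Obj C" and W: "W \<in> Ob Q"
    and h: "h \<in> carrier (Hom Q W (Typ A x))" and t: "t \<in> carrier (Hom Q W (Typ C z))"
  shows "Comp Q W (Typ A x) (Typ C z) (dist_comp Q A B C \<psi> \<phi> x z) h
           \<sqsubseteq>\<^bsub>Hom Q W (Typ C z)\<^esub> t \<longleftrightarrow>
         (\<forall>y\<in>Obj B. Comp Q W (Typ A x) (Typ C z)
            (Comp Q (Typ A x) (Typ B y) (Typ C z) (\<psi> y z) (\<phi> x y)) h \<sqsubseteq>\<^bsub>Hom Q W (Typ C z)\<^esub> t)"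
proof -
  have "(\<lambda>y. Comp Q (Typ A x) (Typ B y) (Typ C z) (\<psi> y z) (\<phi> x y)) ` Obj B
          \<subseteq> carrier (Hom Q (Typ A x) (Typ C z))"
    using x z by (auto intro!: comp_closed Typ_Ob[OF A] Typ_Ob[OF B] Typ_Ob[OF C]
        dist_carrier[OF \<phi>] dist_carrier[OF \<psi>])
  from comp_sup_left_le_iff[OF W Typ_Ob[OF A x] Typ_Ob[OF C z] h this t]
  show ?thesis using x z by (simp add: dist_comp_def)
qed

lemma dist_comp_carrier:
  assumes A: "qcategory Q A" and B: "qcategory Q B" and C: "qcategory Q C"
    and \<phi>: "\<phi> \<in> Dist Q A B" and \<psi>: "\<psi> \<in> Dist Q B C"
    and x: "x \<in> Obj A" and z: "z \<in> Obj C"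
  shows "dist_comp Q A B C \<psi> \<phi> x z \<in> carrier (Hom Q (Typ A x) (Typ C z))"
proof -
  have "\<Squnion>\<^bsub>Hom Q (Typ A x) (Typ C z)\<^esub>
     ((\<lambda>y. Comp Q (Typ A x) (Typ B y) (Typ C z) (\<psi> y z) (\<phi> x y)) ` Obj B)
       \<in> carrier (Hom Q (Typ A x) (Typ C z))"
    using x z by (auto intro!: hom_sup_closed comp_closed Typ_Ob[OF A] Typ_Ob[OF B] Typ_Ob[OF C]
        dist_carrier[OF \<phi>] dist_carrier[OF \<psi>])
  then show ?thesis using x z by (simp add: dist_comp_def)
qed

lemma dist_comp_upper:
  assumes A: "qcategory Q A" and B: "qcategory Q B" and C: "qcategory Q C"
    and \<phi>: "\<phi> \<in> Dist Q A B" and \<psi>: "\<psi> \<in> Dist Q B C"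
    and "x \<in> Obj A" "y \<in> Obj B" "z \<in> Obj C"
  shows "Comp Q (Typ A x) (Typ B y) (Typ C z) (\<psi> y z) (\<phi> x y)
           \<sqsubseteq>\<^bsub>Hom Q (Typ A x) (Typ C z)\<^esub> dist_comp Q A B C \<psi> \<phi> x z"
proof -
  have "dist_le Q A C (dist_comp Q A B C \<psi> \<phi>) (dist_comp Q A B C \<psi> \<phi>)"
    using dist_comp_carrier[OF A B C \<phi> \<psi>] A C
    by (auto simp: dist_le_def intro!: hom_refl Typ_Ob)
  then show ?thesis
    using dist_comp_le_iff[OF A B C dist_carrier[OF \<phi>] dist_carrier[OF \<psi>]
        dist_comp_carrier[OF A B C \<phi> \<psi>]] assms(6-8) by blast
qed

lemma DistI:
  assumes A: "qcategory Q A" and B: "qcategory Q B"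
    and ext: "\<phi> \<in> extensional (Obj A)" "\<And>x. x \<in> Obj A \<Longrightarrow> \<phi> x \<in> extensional (Obj B)"
    and c: "\<And>x y. \<lbrakk>x \<in> Obj A; y \<in> Obj B\<rbrakk> \<Longrightarrow> \<phi> x y \<in> carrier (Hom Q (Typ A x) (Typ B y))"
    and l: "\<And>x y y'. \<lbrakk>x \<in> Obj A; y \<in> Obj B; y' \<in> Obj B\<rbrakk> \<Longrightarrow>
      Comp Q (Typ A x) (Typ B y) (Typ B y') (Arr B y y') (\<phi> x y)
           \<sqsubseteq>\<^bsub>Hom Q (Typ A x) (Typ B y')\<^esub> \<phi> x y'"
    and r: "\<And>x x' y. \<lbrakk>x \<in> Obj A; x' \<in> Obj A; y \<in> Obj B\<rbrakk> \<Longrightarrow>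
      Comp Q (Typ A x') (Typ A x) (Typ B y) (\<phi> x y) (Arr A x' x)
           \<sqsubseteq>\<^bsub>Hom Q (Typ A x') (Typ B y)\<^esub> \<phi> x' y"
  shows "\<phi> \<in> Dist Q A B"
proof -
  have "Comp Q (Typ A x') (Typ B y) (Typ B y') (Arr B y y')
            (Comp Q (Typ A x') (Typ A x) (Typ B y) (\<phi> x y) (Arr A x' x))
            \<sqsubseteq>\<^bsub>Hom Q (Typ A x') (Typ B y')\<^esub> \<phi> x' y'"
    if m: "x \<in> Obj A" "x' \<in> Obj A" "y \<in> Obj B" "y' \<in> Obj B" for x x' y y'
  proof (rule hom_trans)
    note [intro] = Typ_Ob[OF A] Typ_Ob[OF B] Arr_carrier[OF A] Arr_carrier[OF B] c comp_closed hom_refl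
    show "Comp Q (Typ A x') (Typ B y) (Typ B y') (Arr B y y') (\<phi> x' y)
            \<sqsubseteq>\<^bsub>Hom Q (Typ A x') (Typ B y')\<^esub> \<phi> x' y'"
      using l m by blast
    show "Comp Q (Typ A x') (Typ B y) (Typ B y') (Arr B y y')
            (Comp Q (Typ A x') (Typ A x) (Typ B y) (\<phi> x y) (Arr A x' x))
          \<sqsubseteq>\<^bsub>Hom Q (Typ A x') (Typ B y')\<^esub>
          Comp Q (Typ A x') (Typ B y) (Typ B y') (Arr B y y') (\<phi> x' y)"
      using r m by (intro comp_mono) auto
  qed (use m in \<open>auto intro!: comp_closed Typ_Ob[OF A] Typ_Ob[OF B] Arr_carrier[OF A] Arr_carrier[OF B] c\<close>)
  then show ?thesis
    using ext c by (auto simp: Dist_def PiE_def)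
qed

lemma dist_comp_closed:
  assumes A: "qcategory Q A" and B: "qcategory Q B" and C: "qcategory Q C"
    and \<phi>: "\<phi> \<in> Dist Q A B" and \<psi>: "\<psi> \<in> Dist Q B C"
  shows "dist_comp Q A B C \<psi> \<phi> \<in> Dist Q A C"
proof (rule DistI[OF A C])
  note c = Typ_Ob[OF A] Typ_Ob[OF B] Typ_Ob[OF C] Arr_carrier[OF A] Arr_carrier[OF C]
    dist_carrier[OF \<phi>] dist_carrier[OF \<psi>] dist_comp_carrier[OF A B C \<phi> \<psi>]
  fix x z assume xz: "x \<in> Obj A" "z \<in> Obj C"
  show "dist_comp Q A B C \<psi> \<phi> x z \<in> carrier (Hom Q (Typ A x) (Typ C z))"
    using c xz by blast
  show "Comp Q (Typ A x) (Typ C z) (Typ C z') (Arr C z z') (dist_comp Q A B C \<psi> \<phi> x z)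
          \<sqsubseteq>\<^bsub>Hom Q (Typ A x) (Typ C z')\<^esub> dist_comp Q A B C \<psi> \<phi> x z'" if z': "z' \<in> Obj C" for z'
  proof -
    have "Comp Q (Typ A x) (Typ C z) (Typ C z') (Arr C z z')
            (Comp Q (Typ A x) (Typ B y) (Typ C z) (\<psi> y z) (\<phi> x y))
          \<sqsubseteq>\<^bsub>Hom Q (Typ A x) (Typ C z')\<^esub> dist_comp Q A B C \<psi> \<phi> x z'" if y: "y \<in> Obj B" for y
    proof (rule hom_trans)
      show "Comp Q (Typ A x) (Typ C z) (Typ C z') (Arr C z z')
              (Comp Q (Typ A x) (Typ B y) (Typ C z) (\<psi> y z) (\<phi> x y))
          \<sqsubseteq>\<^bsub>Hom Q (Typ A x) (Typ C z')\<^esub> Comp Q (Typ A x) (Typ B y) (Typ C z') (\<psi> y z') (\<phi> x y)"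
        using xz y z'
        by (subst comp_assoc[symmetric]) (auto intro!: comp_mono comp_closed hom_refl c dist_action_left[OF B C \<psi>])
    qed (use xz y z' in \<open>auto intro!: comp_closed c dist_comp_upper[OF A B C \<phi> \<psi>]\<close>)
    then show ?thesis
      using comp_dist_comp_le_iff[OF A B C \<phi> \<psi>] xz z' c by simp
  qed
  show "Comp Q (Typ A x') (Typ A x) (Typ C z) (dist_comp Q A B C \<psi> \<phi> x z) (Arr A x' x)
          \<sqsubseteq>\<^bsub>Hom Q (Typ A x') (Typ C z)\<^esub> dist_comp Q A B C \<psi> \<phi> x' z" if x': "x' \<in> Obj A" for x'
  proof -
    have "Comp Q (Typ A x') (Typ A x) (Typ C z)
            (Comp Q (Typ A x) (Typ B y) (Typ C z) (\<psi> y z) (\<phi> x y)) (Arr A x' x)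
          \<sqsubseteq>\<^bsub>Hom Q (Typ A x') (Typ C z)\<^esub> dist_comp Q A B C \<psi> \<phi> x' z" if y: "y \<in> Obj B" for y
    proof (rule hom_trans)
      show "Comp Q (Typ A x') (Typ A x) (Typ C z)
              (Comp Q (Typ A x) (Typ B y) (Typ C z) (\<psi> y z) (\<phi> x y)) (Arr A x' x)
          \<sqsubseteq>\<^bsub>Hom Q (Typ A x') (Typ C z)\<^esub> Comp Q (Typ A x') (Typ B y) (Typ C z) (\<psi> y z) (\<phi> x' y)"
        using xz y x'
        by (subst comp_assoc) (auto intro!: comp_mono comp_closed hom_refl c dist_action_right[OF A B \<phi>])
    qed (use xz y x' in \<open>auto intro!: comp_closed c dist_comp_upper[OF A B C \<phi> \<psi>]\<close>)
    then show ?thesis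
      using dist_comp_comp_le_iff[OF A B C \<phi> \<psi>] xz x' c by simp
  qed
qed (auto simp: dist_comp_def)

text \<open>
  Associativity of composition of distributors, in the form in which the universal
  properties of the implications use it.
\<close>

lemma dist_comp_assoc_le_iff:
  assumes A: "qcategory Q A" and B: "qcategory Q B" and C: "qcategory Q C" and D: "qcategory Q D"
    and \<phi>: "\<phi> \<in> Dist Q A B" and \<psi>: "\<psi> \<in> Dist Q B C" and \<chi>: "\<chi> \<in> Dist Q C D"
    and \<theta>: "\<theta> \<in> Dist Q A D"
  shows "dist_le Q A D (dist_comp Q A B D (dist_comp Q B C D \<chi> \<psi>) \<phi>) \<theta> \<longleftrightarrow>
         dist_le Q A D (dist_comp Q A C D \<chi> (dist_comp Q A B C \<psi> \<phi>)) \<theta>"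
proof -
  note c = Typ_Ob[OF A] Typ_Ob[OF B] Typ_Ob[OF C] Typ_Ob[OF D]
    dist_carrier[OF \<phi>] dist_carrier[OF \<psi>] dist_carrier[OF \<chi>] dist_carrier[OF \<theta>]
  have "dist_le Q A D (dist_comp Q A B D (dist_comp Q B C D \<chi> \<psi>) \<phi>) \<theta> \<longleftrightarrow>
    (\<forall>w\<in>Obj A. \<forall>x\<in>Obj B. \<forall>z\<in>Obj D. \<forall>y\<in>Obj C.
       Comp Q (Typ A w) (Typ B x) (Typ D z)
         (Comp Q (Typ B x) (Typ C y) (Typ D z) (\<chi> y z) (\<psi> x y)) (\<phi> w x)
       \<sqsubseteq>\<^bsub>Hom Q (Typ A w) (Typ D z)\<^esub> \<theta> w z)"
    using dist_comp_comp_le_iff[OF B C D \<psi> \<chi>] c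
    by (subst dist_comp_le_iff[OF A B D])
       (simp_all add: dist_comp_carrier[OF B C D \<psi> \<chi>])
  also have "\<dots> \<longleftrightarrow> (\<forall>w\<in>Obj A. \<forall>y\<in>Obj C. \<forall>z\<in>Obj D. \<forall>x\<in>Obj B.
       Comp Q (Typ A w) (Typ C y) (Typ D z) (\<chi> y z)
         (Comp Q (Typ A w) (Typ B x) (Typ C y) (\<psi> x y) (\<phi> w x))
       \<sqsubseteq>\<^bsub>Hom Q (Typ A w) (Typ D z)\<^esub> \<theta> w z)"
    using c by (auto simp: comp_assoc)
  also have "\<dots> \<longleftrightarrow> dist_le Q A D (dist_comp Q A C D \<chi> (dist_comp Q A B C \<psi> \<phi>)) \<theta>"
    using comp_dist_comp_le_iff[OF A B C \<phi> \<psi>] c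
    by (subst dist_comp_le_iff[OF A C D])
       (simp_all add: dist_comp_carrier[OF A B C \<phi> \<psi>])
  finally show ?thesis .
qed

text \<open>
  The entry of \<open>\<theta> \<swarrow> \<phi>\<close> at \<open>y, z\<close> is the largest arrow \<open>h\<close> with \<open>h \<circ> \<phi> x y \<le> \<theta> x z\<close> for all
  \<open>x\<close>.  These arrows form a distributor because \<open>\<phi>\<close> and \<open>\<theta>\<close> absorb the hom-arrows of their
  domain and codomain.
\<close>

lemma left_impl_universal:
  assumes A: "qcategory Q A" and B: "qcategory Q B" and C: "qcategory Q C"
    and \<phi>: "\<phi> \<in> Dist Q A B" and \<theta>: "\<theta> \<in> Dist Q A C"
  shows left_impl_closed: "left_impl Q A B C \<theta> \<phi> \<in> Dist Q B C"
    and le_left_impl_iff: "\<psi> \<in> Dist Q B C \<Longrightarrow> dist_le Q B C \<psi> (left_impl Q A B C \<theta> \<phi>) \<longleftrightarrow>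
      dist_le Q A C (dist_comp Q A B C \<psi> \<phi>) \<theta>"
proof -
  note c = Typ_Ob[OF A] Typ_Ob[OF B] Typ_Ob[OF C] Arr_carrier[OF B] Arr_carrier[OF C]
    dist_carrier[OF \<phi>] dist_carrier[OF \<theta>]
  define P where "P y z r \<longleftrightarrow> r \<in> carrier (Hom Q (Typ B y) (Typ C z)) \<and>
      (\<forall>h\<in>carrier (Hom Q (Typ B y) (Typ C z)). h \<sqsubseteq>\<^bsub>Hom Q (Typ B y) (Typ C z)\<^esub> r \<longleftrightarrow>
        (\<forall>x\<in>Obj A. Comp Q (Typ A x) (Typ B y) (Typ C z) h (\<phi> x y)
           \<sqsubseteq>\<^bsub>Hom Q (Typ A x) (Typ C z)\<^esub> \<theta> x z))" for y z r
  have "\<forall>y\<in>Obj B. \<forall>z\<in>Obj C. \<exists>r. P y z r"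
    unfolding P_def using c
    by (intro ballI left_residual_exists[where X = "Typ A" and f = "\<lambda>x. \<phi> x y" and k = "\<lambda>x. \<theta> x z"
          for y z, unfolded Bex_def]) blast+
  then obtain r where P: "\<And>y z. \<lbrakk>y \<in> Obj B; z \<in> Obj C\<rbrakk> \<Longrightarrow> P y z (r y z)"
    by metis
  have r: "\<And>y z. \<lbrakk>y \<in> Obj B; z \<in> Obj C\<rbrakk> \<Longrightarrow> r y z \<in> carrier (Hom Q (Typ B y) (Typ C z))"
    and r_iff: "\<And>y z h. \<lbrakk>y \<in> Obj B; z \<in> Obj C; h \<in> carrier (Hom Q (Typ B y) (Typ C z))\<rbrakk> \<Longrightarrow>
      h \<sqsubseteq>\<^bsub>Hom Q (Typ B y) (Typ C z)\<^esub> r y z \<longleftrightarrow>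
        (\<forall>x\<in>Obj A. Comp Q (Typ A x) (Typ B y) (Typ C z) h (\<phi> x y)
           \<sqsubseteq>\<^bsub>Hom Q (Typ A x) (Typ C z)\<^esub> \<theta> x z)"
    using P by (simp_all add: P_def)
  have r_comp: "Comp Q (Typ A x) (Typ B y) (Typ C z) (r y z) (\<phi> x y)
           \<sqsubseteq>\<^bsub>Hom Q (Typ A x) (Typ C z)\<^esub> \<theta> x z"
    if "x \<in> Obj A" "y \<in> Obj B" "z \<in> Obj C" for x y z
    using r_iff[OF that(2,3) r[OF that(2,3)]] hom_refl[OF _ _ r[OF that(2,3)]] that(1)
      Typ_Ob[OF B that(2)] Typ_Ob[OF C that(3)] by simp
  define \<chi> where "\<chi> = (\<lambda>y\<in>Obj B. \<lambda>z\<in>Obj C. r y z)"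
  have \<chi>: "\<chi> \<in> Dist Q B C"
  proof (rule DistI[OF B C])
    fix y z assume yz: "y \<in> Obj B" "z \<in> Obj C"
    show "\<chi> y z \<in> carrier (Hom Q (Typ B y) (Typ C z))"
      using yz r by (simp add: \<chi>_def)
    show "Comp Q (Typ B y) (Typ C z) (Typ C z') (Arr C z z') (\<chi> y z)
           \<sqsubseteq>\<^bsub>Hom Q (Typ B y) (Typ C z')\<^esub> \<chi> y z'" if z': "z' \<in> Obj C" for z'
    proof -
      have "Comp Q (Typ A x) (Typ B y) (Typ C z')
              (Comp Q (Typ B y) (Typ C z) (Typ C z') (Arr C z z') (r y z)) (\<phi> x y)
            \<sqsubseteq>\<^bsub>Hom Q (Typ A x) (Typ C z')\<^esub> \<theta> x z'" if x: "x \<in> Obj A" for x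
      proof (rule hom_trans)
        show "Comp Q (Typ A x) (Typ B y) (Typ C z')
              (Comp Q (Typ B y) (Typ C z) (Typ C z') (Arr C z z') (r y z)) (\<phi> x y)
            \<sqsubseteq>\<^bsub>Hom Q (Typ A x) (Typ C z')\<^esub> Comp Q (Typ A x) (Typ C z) (Typ C z') (Arr C z z') (\<theta> x z)"
          using x yz z'
          by (subst comp_assoc) (auto intro!: comp_mono comp_closed hom_refl c r r_comp)
      qed (use x yz z' in \<open>auto intro!: comp_closed c r r_comp dist_action_left[OF A C \<theta>]\<close>)
      then show ?thesis
        using yz z' by (simp add: \<chi>_def) (subst r_iff, auto intro!: comp_closed c r)
    qed
    show "Comp Q (Typ B y') (Typ B y) (Typ C z) (\<chi> y z) (Arr B y' y)
           \<sqsubseteq>\<^bsub>Hom Q (Typ B y') (Typ C z)\<^esub> \<chi> y' z" if y': "y' \<in> Obj B" for y'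
    proof -
      have "Comp Q (Typ A x) (Typ B y') (Typ C z)
              (Comp Q (Typ B y') (Typ B y) (Typ C z) (r y z) (Arr B y' y)) (\<phi> x y')
            \<sqsubseteq>\<^bsub>Hom Q (Typ A x) (Typ C z)\<^esub> \<theta> x z" if x: "x \<in> Obj A" for x
      proof (rule hom_trans)
        show "Comp Q (Typ A x) (Typ B y') (Typ C z)
              (Comp Q (Typ B y') (Typ B y) (Typ C z) (r y z) (Arr B y' y)) (\<phi> x y')
            \<sqsubseteq>\<^bsub>Hom Q (Typ A x) (Typ C z)\<^esub> Comp Q (Typ A x) (Typ B y) (Typ C z) (r y z) (\<phi> x y)"
          using x yz y'
          by (subst comp_assoc) (auto intro!: comp_mono comp_closed hom_refl c r r_comp dist_action_left[OF A B \<phi>])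
      qed (use x yz y' in \<open>auto intro!: comp_closed c r r_comp\<close>)
      then show ?thesis
        using yz y' by (simp add: \<chi>_def) (subst r_iff, auto intro!: comp_closed c r)
    qed
  qed (auto simp: \<chi>_def)
  have iff: "dist_le Q A C (dist_comp Q A B C \<psi> \<phi>) \<theta> \<longleftrightarrow> dist_le Q B C \<psi> \<chi>"
    if \<psi>: "\<psi> \<in> Dist Q B C" for \<psi>
    using dist_carrier[OF \<psi>] c r_iff
    by (subst dist_comp_le_iff[OF A B C]) (auto simp: dist_le_def \<chi>_def)
  have "left_impl Q A B C \<theta> \<phi> = \<chi>"
    using B C \<chi> iff by (rule left_impl_eqI)
  then show "left_impl Q A B C \<theta> \<phi> \<in> Dist Q B C"
    and "\<psi> \<in> Dist Q B C \<Longrightarrow> dist_le Q B C \<psi> (left_impl Q A B C \<theta> \<phi>) \<longleftrightarrow>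
      dist_le Q A C (dist_comp Q A B C \<psi> \<phi>) \<theta>"
    using \<chi> iff by simp_all
qed

lemma right_impl_universal:
  assumes A: "qcategory Q A" and B: "qcategory Q B" and C: "qcategory Q C"
    and \<psi>: "\<psi> \<in> Dist Q B C" and \<theta>: "\<theta> \<in> Dist Q A C"
  shows right_impl_closed: "right_impl Q A B C \<psi> \<theta> \<in> Dist Q A B"
    and le_right_impl_iff: "\<phi> \<in> Dist Q A B \<Longrightarrow> dist_le Q A B \<phi> (right_impl Q A B C \<psi> \<theta>) \<longleftrightarrow>
      dist_le Q A C (dist_comp Q A B C \<psi> \<phi>) \<theta>"
proof -
  note c = Typ_Ob[OF A] Typ_Ob[OF B] Typ_Ob[OF C] Arr_carrier[OF A] Arr_carrier[OF B]
    dist_carrier[OF \<psi>] dist_carrier[OF \<theta>]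
  define P where "P x y r \<longleftrightarrow> r \<in> carrier (Hom Q (Typ A x) (Typ B y)) \<and>
      (\<forall>h\<in>carrier (Hom Q (Typ A x) (Typ B y)). h \<sqsubseteq>\<^bsub>Hom Q (Typ A x) (Typ B y)\<^esub> r \<longleftrightarrow>
        (\<forall>z\<in>Obj C. Comp Q (Typ A x) (Typ B y) (Typ C z) (\<psi> y z) h
           \<sqsubseteq>\<^bsub>Hom Q (Typ A x) (Typ C z)\<^esub> \<theta> x z))" for x y r
  have "\<forall>x\<in>Obj A. \<forall>y\<in>Obj B. \<exists>r. P x y r"
    unfolding P_def using c
    by (intro ballI right_residual_exists[where Z = "Typ C" and g = "\<lambda>z. \<psi> y z" and k = "\<lambda>z. \<theta> x z"
          for x y, unfolded Bex_def]) blast+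
  then obtain r where P: "\<And>x y. \<lbrakk>x \<in> Obj A; y \<in> Obj B\<rbrakk> \<Longrightarrow> P x y (r x y)"
    by metis
  have r: "\<And>x y. \<lbrakk>x \<in> Obj A; y \<in> Obj B\<rbrakk> \<Longrightarrow> r x y \<in> carrier (Hom Q (Typ A x) (Typ B y))"
    and r_iff: "\<And>x y h. \<lbrakk>x \<in> Obj A; y \<in> Obj B; h \<in> carrier (Hom Q (Typ A x) (Typ B y))\<rbrakk> \<Longrightarrow>
      h \<sqsubseteq>\<^bsub>Hom Q (Typ A x) (Typ B y)\<^esub> r x y \<longleftrightarrow>
        (\<forall>z\<in>Obj C. Comp Q (Typ A x) (Typ B y) (Typ C z) (\<psi> y z) h
           \<sqsubseteq>\<^bsub>Hom Q (Typ A x) (Typ C z)\<^esub> \<theta> x z)"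
    using P by (simp_all add: P_def)
  have r_comp: "Comp Q (Typ A x) (Typ B y) (Typ C z) (\<psi> y z) (r x y)
           \<sqsubseteq>\<^bsub>Hom Q (Typ A x) (Typ C z)\<^esub> \<theta> x z"
    if "x \<in> Obj A" "y \<in> Obj B" "z \<in> Obj C" for x y z
    using r_iff[OF that(1,2) r[OF that(1,2)]] hom_refl[OF _ _ r[OF that(1,2)]] that(3)
      Typ_Ob[OF A that(1)] Typ_Ob[OF B that(2)] by simp
  define \<chi> where "\<chi> = (\<lambda>x\<in>Obj A. \<lambda>y\<in>Obj B. r x y)"
  have \<chi>: "\<chi> \<in> Dist Q A B"
  proof (rule DistI[OF A B])
    fix x y assume xy: "x \<in> Obj A" "y \<in> Obj B"
    show "\<chi> x y \<in> carrier (Hom Q (Typ A x) (Typ B y))"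
      using xy r by (simp add: \<chi>_def)
    show "Comp Q (Typ A x) (Typ B y) (Typ B y') (Arr B y y') (\<chi> x y)
           \<sqsubseteq>\<^bsub>Hom Q (Typ A x) (Typ B y')\<^esub> \<chi> x y'" if y': "y' \<in> Obj B" for y'
    proof -
      have "Comp Q (Typ A x) (Typ B y') (Typ C z) (\<psi> y' z)
              (Comp Q (Typ A x) (Typ B y) (Typ B y') (Arr B y y') (r x y))
            \<sqsubseteq>\<^bsub>Hom Q (Typ A x) (Typ C z)\<^esub> \<theta> x z" if z: "z \<in> Obj C" for z
      proof (rule hom_trans)
        show "Comp Q (Typ A x) (Typ B y') (Typ C z) (\<psi> y' z)
              (Comp Q (Typ A x) (Typ B y) (Typ B y') (Arr B y y') (r x y))
            \<sqsubseteq>\<^bsub>Hom Q (Typ A x) (Typ C z)\<^esub> Comp Q (Typ A x) (Typ B y) (Typ C z) (\<psi> y z) (r x y)"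
          using z xy y'
          by (subst comp_assoc[symmetric]) (auto intro!: comp_mono comp_closed hom_refl c r r_comp dist_action_right[OF B C \<psi>])
      qed (use z xy y' in \<open>auto intro!: comp_closed c r r_comp\<close>)
      then show ?thesis
        using xy y' by (simp add: \<chi>_def) (subst r_iff, auto intro!: comp_closed c r)
    qed
    show "Comp Q (Typ A x') (Typ A x) (Typ B y) (\<chi> x y) (Arr A x' x)
           \<sqsubseteq>\<^bsub>Hom Q (Typ A x') (Typ B y)\<^esub> \<chi> x' y" if x': "x' \<in> Obj A" for x'
    proof -
      have "Comp Q (Typ A x') (Typ B y) (Typ C z) (\<psi> y z)
              (Comp Q (Typ A x') (Typ A x) (Typ B y) (r x y) (Arr A x' x))
            \<sqsubseteq>\<^bsub>Hom Q (Typ A x') (Typ C z)\<^esub> \<theta> x' z" if z: "z \<in> Obj C" for z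
      proof (rule hom_trans)
        show "Comp Q (Typ A x') (Typ B y) (Typ C z) (\<psi> y z)
              (Comp Q (Typ A x') (Typ A x) (Typ B y) (r x y) (Arr A x' x))
            \<sqsubseteq>\<^bsub>Hom Q (Typ A x') (Typ C z)\<^esub> Comp Q (Typ A x') (Typ A x) (Typ C z) (\<theta> x z) (Arr A x' x)"
          using z xy x'
          by (subst comp_assoc[symmetric]) (auto intro!: comp_mono comp_closed hom_refl c r r_comp)
      qed (use z xy x' in \<open>auto intro!: comp_closed c r r_comp dist_action_right[OF A C \<theta>]\<close>)
      then show ?thesis
        using xy x' by (simp add: \<chi>_def) (subst r_iff, auto intro!: comp_closed c r)
    qed
  qed (auto simp: \<chi>_def)
  have iff: "dist_le Q A C (dist_comp Q A B C \<psi> \<phi>) \<theta> \<longleftrightarrow> dist_le Q A B \<phi> \<chi>"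
    if \<phi>: "\<phi> \<in> Dist Q A B" for \<phi>
    using dist_carrier[OF \<phi>] c r_iff
    by (subst dist_comp_le_iff[OF A B C]) (auto simp: dist_le_def \<chi>_def)
  have "right_impl Q A B C \<psi> \<theta> = \<chi>"
    using A B \<chi> iff by (rule right_impl_eqI)
  then show "right_impl Q A B C \<psi> \<theta> \<in> Dist Q A B"
    and "\<phi> \<in> Dist Q A B \<Longrightarrow> dist_le Q A B \<phi> (right_impl Q A B C \<psi> \<theta>) \<longleftrightarrow>
      dist_le Q A C (dist_comp Q A B C \<psi> \<phi>) \<theta>"
    using \<chi> iff by simp_all
qed


lemma dist_le_trans:
  assumes A: "qcategory Q A" and B: "qcategory Q B"
    and d: "\<phi> \<in> Dist Q A B" "\<psi> \<in> Dist Q A B" "\<chi> \<in> Dist Q A B"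
    and le: "dist_le Q A B \<phi> \<psi>" "dist_le Q A B \<psi> \<chi>"
  shows "dist_le Q A B \<phi> \<chi>"
  unfolding dist_le_def
proof (intro ballI)
  fix x y assume xy: "x \<in> Obj A" "y \<in> Obj B"
  show "\<phi> x y \<sqsubseteq>\<^bsub>Hom Q (Typ A x) (Typ B y)\<^esub> \<chi> x y"
    by (rule hom_trans[of _ _ _ "\<psi> x y"])
       (use le xy Typ_Ob[OF A] Typ_Ob[OF B] dist_carrier[OF d(1)] dist_carrier[OF d(2)]
          dist_carrier[OF d(3)] in \<open>simp_all add: dist_le_def\<close>)
qed

text \<open>
  This and the next two identities hold because both sides have the same lower bounds, by
  the universal properties and associativity.
\<close>

lemma left_impl_left_impl:
  assumes A: "qcategory Q A" and B: "qcategory Q B" and C: "qcategory Q C" and D: "qcategory Q D"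
    and \<phi>: "\<phi> \<in> Dist Q A B" and \<psi>: "\<psi> \<in> Dist Q B C" and \<theta>: "\<theta> \<in> Dist Q A D"
  shows "left_impl Q B C D (left_impl Q A B D \<theta> \<phi>) \<psi>
       = left_impl Q A C D \<theta> (dist_comp Q A B C \<psi> \<phi>)"
proof (rule dist_eqI[OF C D])
  note k = left_impl_closed[OF A B D \<phi> \<theta>] and c = dist_comp_closed[OF A B C \<phi> \<psi>]
  show "left_impl Q B C D (left_impl Q A B D \<theta> \<phi>) \<psi> \<in> Dist Q C D"
    using k by (rule left_impl_closed[OF B C D \<psi>])
  show "left_impl Q A C D \<theta> (dist_comp Q A B C \<psi> \<phi>) \<in> Dist Q C D"
    using c \<theta> by (rule left_impl_closed[OF A C D])
  fix \<chi> assume \<chi>: "\<chi> \<in> Dist Q C D"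
  show "dist_le Q C D \<chi> (left_impl Q B C D (left_impl Q A B D \<theta> \<phi>) \<psi>) \<longleftrightarrow>
        dist_le Q C D \<chi> (left_impl Q A C D \<theta> (dist_comp Q A B C \<psi> \<phi>))"
    by (simp add: le_left_impl_iff[OF B C D \<psi> k \<chi>] le_left_impl_iff[OF A C D c \<theta> \<chi>]
        le_left_impl_iff[OF A B D \<phi> \<theta> dist_comp_closed[OF B C D \<psi> \<chi>]]
        dist_comp_assoc_le_iff[OF A B C D \<phi> \<psi> \<chi> \<theta>])
qed

lemma right_impl_right_impl:
  assumes A: "qcategory Q A" and B: "qcategory Q B" and C: "qcategory Q C" and D: "qcategory Q D"
    and \<psi>: "\<psi> \<in> Dist Q B C" and \<chi>: "\<chi> \<in> Dist Q C D" and \<theta>: "\<theta> \<in> Dist Q A D"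
  shows "right_impl Q A B C \<psi> (right_impl Q A C D \<chi> \<theta>)
       = right_impl Q A B D (dist_comp Q B C D \<chi> \<psi>) \<theta>"
proof (rule dist_eqI[OF A B])
  note k = right_impl_closed[OF A C D \<chi> \<theta>] and c = dist_comp_closed[OF B C D \<psi> \<chi>]
  show "right_impl Q A B C \<psi> (right_impl Q A C D \<chi> \<theta>) \<in> Dist Q A B"
    using k by (rule right_impl_closed[OF A B C \<psi>])
  show "right_impl Q A B D (dist_comp Q B C D \<chi> \<psi>) \<theta> \<in> Dist Q A B"
    using c \<theta> by (rule right_impl_closed[OF A B D])
  fix \<phi> assume \<phi>: "\<phi> \<in> Dist Q A B"
  show "dist_le Q A B \<phi> (right_impl Q A B C \<psi> (right_impl Q A C D \<chi> \<theta>)) \<longleftrightarrow>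
        dist_le Q A B \<phi> (right_impl Q A B D (dist_comp Q B C D \<chi> \<psi>) \<theta>)"
    by (simp add: le_right_impl_iff[OF A B C \<psi> k \<phi>] le_right_impl_iff[OF A B D c \<theta> \<phi>]
        le_right_impl_iff[OF A C D \<chi> \<theta> dist_comp_closed[OF A B C \<phi> \<psi>]]
        dist_comp_assoc_le_iff[OF A B C D \<phi> \<psi> \<chi> \<theta>])
qed

lemma left_impl_right_impl:
  assumes A: "qcategory Q A" and B: "qcategory Q B" and C: "qcategory Q C" and D: "qcategory Q D"
    and \<phi>: "\<phi> \<in> Dist Q A B" and \<psi>: "\<psi> \<in> Dist Q C D" and \<theta>: "\<theta> \<in> Dist Q A D"
  shows "left_impl Q A B C (right_impl Q A C D \<psi> \<theta>) \<phi>
       = right_impl Q B C D \<psi> (left_impl Q A B D \<theta> \<phi>)"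
proof (rule dist_eqI[OF B C])
  note r = right_impl_closed[OF A C D \<psi> \<theta>] and l = left_impl_closed[OF A B D \<phi> \<theta>]
  show "left_impl Q A B C (right_impl Q A C D \<psi> \<theta>) \<phi> \<in> Dist Q B C"
    using r by (rule left_impl_closed[OF A B C \<phi>])
  show "right_impl Q B C D \<psi> (left_impl Q A B D \<theta> \<phi>) \<in> Dist Q B C"
    using l by (rule right_impl_closed[OF B C D \<psi>])
  fix \<chi> assume \<chi>: "\<chi> \<in> Dist Q B C"
  show "dist_le Q B C \<chi> (left_impl Q A B C (right_impl Q A C D \<psi> \<theta>) \<phi>) \<longleftrightarrow>
        dist_le Q B C \<chi> (right_impl Q B C D \<psi> (left_impl Q A B D \<theta> \<phi>))"
    by (simp add: le_left_impl_iff[OF A B C \<phi> r \<chi>] le_right_impl_iff[OF B C D \<psi> l \<chi>]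
        le_right_impl_iff[OF A C D \<psi> \<theta> dist_comp_closed[OF A B C \<phi> \<chi>]]
        le_left_impl_iff[OF A B D \<phi> \<theta> dist_comp_closed[OF B C D \<chi> \<psi>]]
        dist_comp_assoc_le_iff[OF A B C D \<phi> \<chi> \<psi> \<theta>])
qed

text \<open>
  The maps \<open>\<mu> \<mapsto> \<phi> \<swarrow> \<mu>\<close> and \<open>\<kappa> \<mapsto> \<kappa> \<searrow> \<phi>\<close> form a Galois connection, both
  \<open>\<kappa> \<le> \<phi> \<swarrow> \<mu>\<close> and \<open>\<mu> \<le> \<kappa> \<searrow> \<phi>\<close> being equivalent to \<open>\<kappa> \<circ> \<mu> \<le> \<phi>\<close>; these are its
  triangle identities.
\<close>

lemma isbell_triangle_identities:
  assumes A: "qcategory Q A" and B: "qcategory Q B" and C: "qcategory Q C" and \<phi>: "\<phi> \<in> Dist Q A B"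
  shows left_impl_isbell_closure: "\<mu> \<in> Dist Q A C \<Longrightarrow>
      left_impl Q A C B \<phi> (right_impl Q A C B (left_impl Q A C B \<phi> \<mu>) \<phi>) = left_impl Q A C B \<phi> \<mu>"
    and right_impl_isbell_closure: "\<kappa> \<in> Dist Q C B \<Longrightarrow>
      right_impl Q A C B (left_impl Q A C B \<phi> (right_impl Q A C B \<kappa> \<phi>)) \<phi> = right_impl Q A C B \<kappa> \<phi>"
proof -
  let ?u = "left_impl Q A C B \<phi>" and ?d = "\<lambda>\<kappa>. right_impl Q A C B \<kappa> \<phi>"
  have u: "?u \<mu> \<in> Dist Q C B" if "\<mu> \<in> Dist Q A C" for \<mu>
    using that \<phi> by (rule left_impl_closed[OF A C B])
  have d: "?d \<kappa> \<in> Dist Q A C" if "\<kappa> \<in> Dist Q C B" for \<kappa>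
    using that \<phi> by (rule right_impl_closed[OF A C B])
  have gal: "dist_le Q C B \<kappa> (?u \<mu>) \<longleftrightarrow> dist_le Q A C \<mu> (?d \<kappa>)"
    if "\<mu> \<in> Dist Q A C" "\<kappa> \<in> Dist Q C B" for \<mu> \<kappa>
    by (simp add: le_left_impl_iff[OF A C B that(1) \<phi> that(2)]
        le_right_impl_iff[OF A C B that(2) \<phi> that(1)])
  have unit: "dist_le Q A C \<mu> (?d (?u \<mu>))" if "\<mu> \<in> Dist Q A C" for \<mu>
    using gal[OF that u[OF that]] dist_le_refl[OF C B u[OF that]] by simp
  have unit': "dist_le Q C B \<kappa> (?u (?d \<kappa>))" if "\<kappa> \<in> Dist Q C B" for \<kappa>
    using gal[OF d[OF that] that] dist_le_refl[OF A C d[OF that]] by simp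
  show "?u (?d (?u \<mu>)) = ?u \<mu>" if \<mu>: "\<mu> \<in> Dist Q A C"
  proof (rule dist_antisym[OF C B])
    have "dist_le Q A C \<mu> (?d (?u (?d (?u \<mu>))))"
      using dist_le_trans[OF A C _ _ _ unit unit] \<mu> u d by blast
    then show "dist_le Q C B (?u (?d (?u \<mu>))) (?u \<mu>)"
      using gal \<mu> u d by blast
  qed (use \<mu> u d unit' in blast)+
  show "?d (?u (?d \<kappa>)) = ?d \<kappa>" if \<kappa>: "\<kappa> \<in> Dist Q C B"
  proof (rule dist_antisym[OF A C])
    have "dist_le Q C B \<kappa> (?u (?d (?u (?d \<kappa>))))"
      using dist_le_trans[OF C B _ _ _ unit' unit'] \<kappa> u d by blast
    then show "dist_le Q A C (?d (?u (?d \<kappa>))) (?d \<kappa>)"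
      using gal \<kappa> u d by blast
  qed (use \<kappa> u d unit in blast)+
qed

lemma left_impl_dist_id:
  assumes A: "qcategory Q A" and B: "qcategory Q B" and \<phi>: "\<phi> \<in> Dist Q A B"
  shows "left_impl Q A A B \<phi> (dist_id A) = \<phi>"
  using left_impl_incl[OF A B \<phi> subset_refl] dist_restrict_Obj[OF \<phi>]
  by (simp add: incl_eq_dist_id)

text \<open>
  Composition of hom-arrows in a presheaf category: the composite \<open>(\<chi> \<swarrow> \<psi>) \<circ> (\<psi> \<swarrow> \<phi>)\<close>
  sends \<open>\<phi>\<close> below \<open>\<psi>\<close> and then \<open>\<psi>\<close> below \<open>\<chi>\<close>.
\<close>

lemma left_impl_comp_le:
  assumes A: "qcategory Q A" and B: "qcategory Q B" and C: "qcategory Q C" and D: "qcategory Q D"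
    and \<phi>: "\<phi> \<in> Dist Q A B" and \<psi>: "\<psi> \<in> Dist Q A C" and \<chi>: "\<chi> \<in> Dist Q A D"
  shows "dist_le Q B D (dist_comp Q B C D (left_impl Q A C D \<chi> \<psi>) (left_impl Q A B C \<psi> \<phi>))
           (left_impl Q A B D \<chi> \<phi>)"
proof -
  let ?f = "left_impl Q A B C \<psi> \<phi>" and ?g = "left_impl Q A C D \<chi> \<psi>"
  have f: "?f \<in> Dist Q B C" and g: "?g \<in> Dist Q C D"
    using left_impl_closed[OF A B C \<phi> \<psi>] left_impl_closed[OF A C D \<psi> \<chi>] by auto
  have "dist_le Q A C (dist_comp Q A B C ?f \<phi>) \<psi>"
    using le_left_impl_iff[OF A B C \<phi> \<psi> f] dist_le_refl[OF B C f] by simp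
  moreover have "dist_le Q A C \<psi> (right_impl Q A C D ?g \<chi>)"
    using le_left_impl_iff[OF A C D \<psi> \<chi> g] dist_le_refl[OF C D g]
    by (simp add: le_right_impl_iff[OF A C D g \<chi> \<psi>])
  ultimately have "dist_le Q A C (dist_comp Q A B C ?f \<phi>) (right_impl Q A C D ?g \<chi>)"
    using dist_le_trans[OF A C dist_comp_closed[OF A B C \<phi> f] \<psi> right_impl_closed[OF A C D g \<chi>]]
    by blast
  then show ?thesis
    by (simp add: le_left_impl_iff[OF A B D \<phi> \<chi> dist_comp_closed[OF B C D f g]]
        dist_comp_assoc_le_iff[OF A B C D \<phi> f g \<chi>]
        le_right_impl_iff[OF A C D g \<chi> dist_comp_closed[OF A B C \<phi> f]])
qed


section \<open>Adjunctions and isomorphisms between categories over a quantaloid\<close>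

lemma qle_refl: "\<lbrakk>qcategory Q A; x \<in> Obj A\<rbrakk> \<Longrightarrow> qle Q A x x"
  by (simp add: qle_def qcategory_def)

lemma Arr_mono_right:
  assumes A: "qcategory Q A" and m: "x \<in> Obj A" "y \<in> Obj A" "z \<in> Obj A" and le: "qle Q A y z"
  shows "Arr A x y \<sqsubseteq>\<^bsub>Hom Q (Typ A x) (Typ A z)\<^esub> Arr A x z"
proof (rule hom_trans)
  let ?c = "Comp Q (Typ A x) (Typ A y) (Typ A z) (Arr A y z) (Arr A x y)"
  have "Comp Q (Typ A x) (Typ A y) (Typ A y) (Ident Q (Typ A y)) (Arr A x y)
      \<sqsubseteq>\<^bsub>Hom Q (Typ A x) (Typ A y)\<^esub> Comp Q (Typ A x) (Typ A y) (Typ A y) (Arr A y z) (Arr A x y)"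
    using m le Arr_carrier[OF A m(2,3)] Arr_carrier[OF A m(1,2)]
    by (intro comp_mono) (auto simp: qle_def intro!: hom_refl ident_closed Typ_Ob[OF A] Arr_carrier[OF A])
  then show "Arr A x y \<sqsubseteq>\<^bsub>Hom Q (Typ A x) (Typ A z)\<^esub> ?c"
    using le comp_ident_left[OF Typ_Ob Typ_Ob Arr_carrier, OF A m(1) A m(2) A m(1,2)]
    by (simp add: qle_def)
  show "?c \<sqsubseteq>\<^bsub>Hom Q (Typ A x) (Typ A z)\<^esub> Arr A x z"
    using A m by (simp add: qcategory_def)
  show "Arr A x y \<in> carrier (Hom Q (Typ A x) (Typ A z))"
    using Arr_carrier[OF A m(1,2)] le by (simp add: qle_def)
qed (use m in \<open>auto intro!: comp_closed Typ_Ob[OF A] Arr_carrier[OF A]\<close>)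

lemma Arr_mono_left:
  assumes A: "qcategory Q A" and m: "x \<in> Obj A" "y \<in> Obj A" "z \<in> Obj A" and le: "qle Q A x y"
  shows "Arr A y z \<sqsubseteq>\<^bsub>Hom Q (Typ A x) (Typ A z)\<^esub> Arr A x z"
proof (rule hom_trans)
  let ?c = "Comp Q (Typ A x) (Typ A y) (Typ A z) (Arr A y z) (Arr A x y)"
  have "Comp Q (Typ A y) (Typ A y) (Typ A z) (Arr A y z) (Ident Q (Typ A y))
      \<sqsubseteq>\<^bsub>Hom Q (Typ A y) (Typ A z)\<^esub> Comp Q (Typ A y) (Typ A y) (Typ A z) (Arr A y z) (Arr A x y)"
    using m le Arr_carrier[OF A m(1,2)]
    by (intro comp_mono) (auto simp: qle_def intro!: hom_refl ident_closed Typ_Ob[OF A] Arr_carrier[OF A])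
  then show "Arr A y z \<sqsubseteq>\<^bsub>Hom Q (Typ A x) (Typ A z)\<^esub> ?c"
    using le comp_ident_right[OF Typ_Ob Typ_Ob Arr_carrier, OF A m(2) A m(3) A m(2,3)]
    by (simp add: qle_def)
  show "?c \<sqsubseteq>\<^bsub>Hom Q (Typ A x) (Typ A z)\<^esub> Arr A x z"
    using A m by (simp add: qcategory_def)
  show "Arr A y z \<in> carrier (Hom Q (Typ A x) (Typ A z))"
    using Arr_carrier[OF A m(2,3)] le by (simp add: qle_def)
qed (use m in \<open>auto intro!: comp_closed Typ_Ob[OF A] Arr_carrier[OF A]\<close>)

lemma qle_trans:
  assumes A: "qcategory Q A" and m: "x \<in> Obj A" "y \<in> Obj A" "z \<in> Obj A"
    and le: "qle Q A x y" "qle Q A y z"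
  shows "qle Q A x z"
proof -
  have "Ident Q (Typ A x) \<sqsubseteq>\<^bsub>Hom Q (Typ A x) (Typ A x)\<^esub> Arr A x z"
    by (rule hom_trans[of _ _ _ "Arr A x y"])
       (use Arr_mono_right[OF A m le(2)] le Arr_carrier[OF A m(1,2)] Arr_carrier[OF A m(1,3)]
          Typ_Ob[OF A m(1)] ident_closed in \<open>auto simp: qle_def\<close>)
  then show ?thesis using le by (simp add: qle_def)
qed

lemma qfunctor_qle:
  assumes F: "qfunctor Q A B F" and A: "qcategory Q A" and B: "qcategory Q B"
    and m: "x \<in> Obj A" "y \<in> Obj A" and le: "qle Q A x y"
  shows "qle Q B (F x) (F y)"
proof -
  have t: "Typ B (F x) = Typ A x" "Typ B (F y) = Typ A x" "Typ A y = Typ A x"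
    and o: "F x \<in> Obj B" "F y \<in> Obj B"
    using F m le by (auto simp: qfunctor_def qle_def)
  have f: "Arr A x y \<sqsubseteq>\<^bsub>Hom Q (Typ A x) (Typ A x)\<^esub> Arr B (F x) (F y)"
    using F m t(3) unfolding qfunctor_def by metis
  have "Ident Q (Typ A x) \<sqsubseteq>\<^bsub>Hom Q (Typ A x) (Typ A x)\<^esub> Arr B (F x) (F y)"
    by (rule hom_trans[OF _ _ _ f])
       (use le Arr_carrier[OF A m] Arr_carrier[OF B o] Typ_Ob[OF A m(1)] ident_closed
         in \<open>simp_all add: qle_def t\<close>)
  then show ?thesis using t by (simp add: qle_def)
qed

text \<open>
  An equality of hom-arrows yields more than the unit and counit: it also makes \<open>F\<close> and \<open>G\<close>
  functors, by the Yoneda argument, since composing with the unit turns an arrow \<open>x \<rightarrow> x'\<close> into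
  one \<open>x \<rightarrow> G (F x')\<close>, that is, \<open>F x \<rightarrow> F x'\<close>.
\<close>

lemma qadjunctionI:
  assumes A: "qcategory Q A" and B: "qcategory Q B"
    and F: "F \<in> Obj A \<rightarrow>\<^sub>E Obj B" and G: "G \<in> Obj B \<rightarrow>\<^sub>E Obj A"
    and tF: "\<And>x. x \<in> Obj A \<Longrightarrow> Typ B (F x) = Typ A x"
    and tG: "\<And>y. y \<in> Obj B \<Longrightarrow> Typ A (G y) = Typ B y"
    and hom: "\<And>x y. \<lbrakk>x \<in> Obj A; y \<in> Obj B\<rbrakk> \<Longrightarrow> Arr B (F x) y = Arr A x (G y)"
  shows "qadjunction Q A B F G"
proof -
  have oF: "F x \<in> Obj B" if "x \<in> Obj A" for x using F that by auto
  have oG: "G y \<in> Obj A" if "y \<in> Obj B" for y using G that by auto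
  have unit: "qle Q A x (G (F x))" if x: "x \<in> Obj A" for x
    using qle_refl[OF B oF[OF x]] hom[OF x oF[OF x]] x oF tF tG by (simp add: qle_def)
  have counit: "qle Q B (F (G y)) y" if y: "y \<in> Obj B" for y
    using qle_refl[OF A oG[OF y]] hom[OF oG[OF y] y] y oG tF tG by (simp add: qle_def)
  have "qfunctor Q A B F"
    using F tF tG Arr_mono_right[OF A _ _ _ unit] hom oF oG by (auto simp: qfunctor_def)
  moreover have "qfunctor Q B A G"
    using G tG tF Arr_mono_left[OF B _ _ _ counit] hom oF oG by (auto simp: qfunctor_def)
  ultimately show ?thesis
    using unit counit by (auto simp: qadjunction_def functor_le_def functor_id_def compose_def)
qed

lemma right_adjoint_eqI:
  assumes A: "qcategory Q A" and B: "qcategory Q B"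
    and skel: "\<And>x y. \<lbrakk>x \<in> Obj A; y \<in> Obj A; qle Q A x y; qle Q A y x\<rbrakk> \<Longrightarrow> x = y"
    and adj: "qadjunction Q A B F G"
  shows "right_adjoint Q A B F = G"
  unfolding right_adjoint_def
proof (rule the_equality)
  have le: "qle Q A (G y) (G' y)"
    if a: "qadjunction Q A B F G" and a': "qadjunction Q A B F G'" and y: "y \<in> Obj B" for G G' y
  proof (rule qle_trans[OF A])
    have o: "G y \<in> Obj A" "G' y \<in> Obj A" "F (G y) \<in> Obj B" "G' (F (G y)) \<in> Obj A"
      using a a' y by (auto simp: qadjunction_def qfunctor_def)
    then show "G y \<in> Obj A" "G' (F (G y)) \<in> Obj A" "G' y \<in> Obj A" by auto
    show "qle Q A (G y) (G' (F (G y)))"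
      using a' o by (auto simp: qadjunction_def functor_le_def functor_id_def compose_def)
    have "qle Q B (F (G y)) y"
      using a y by (auto simp: qadjunction_def functor_le_def functor_id_def compose_def)
    then show "qle Q A (G' (F (G y))) (G' y)"
      using a' o y by (intro qfunctor_qle[OF _ B A]) (auto simp: qadjunction_def)
  qed
  show "qadjunction Q A B F G" by (rule adj)
  fix G' assume adj': "qadjunction Q A B F G'"
  show "G' = G"
  proof (rule PiE_ext)
    show "G' \<in> Obj B \<rightarrow>\<^sub>E Obj A" "G \<in> Obj B \<rightarrow>\<^sub>E Obj A"
      using adj adj' by (auto simp: qadjunction_def qfunctor_def)
    then show "G' y = G y" if "y \<in> Obj B" for y
      using le[OF adj adj' that] le[OF adj' adj that] that by (intro skel) auto
  qed
qed

lemma qfunctor_compose: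
  assumes F: "qfunctor Q A B F" and G: "qfunctor Q B C G"
    and A: "qcategory Q A" and B: "qcategory Q B" and C: "qcategory Q C"
  shows "qfunctor Q A C (compose (Obj A) G F)"
proof -
  have types: "Typ C (G (F x)) = Typ A x" if "x \<in> Obj A" for x
    using F G that unfolding qfunctor_def by (metis PiE_mem)
  have "Arr A x y \<sqsubseteq>\<^bsub>Hom Q (Typ A x) (Typ A y)\<^esub> Arr C (G (F x)) (G (F y))"
    if m: "x \<in> Obj A" "y \<in> Obj A" for x y
  proof -
    have o: "F x \<in> Obj B" "F y \<in> Obj B" "G (F x) \<in> Obj C" "G (F y) \<in> Obj C"
      and t: "Typ B (F x) = Typ A x" "Typ B (F y) = Typ A y"
        "Typ C (G (F x)) = Typ A x" "Typ C (G (F y)) = Typ A y"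
      using F G m types by (auto simp: qfunctor_def)
    have le: "Arr A x y \<sqsubseteq>\<^bsub>Hom Q (Typ A x) (Typ A y)\<^esub> Arr B (F x) (F y)"
      "Arr B (F x) (F y) \<sqsubseteq>\<^bsub>Hom Q (Typ B (F x)) (Typ B (F y))\<^esub> Arr C (G (F x)) (G (F y))"
      using F G m o unfolding qfunctor_def by blast+
    show ?thesis
      by (rule hom_trans[OF _ _ le(1) le(2)[unfolded t]])
         (use m t Typ_Ob[OF A] Arr_carrier[OF A m] Arr_carrier[OF B o(1,2)] Arr_carrier[OF C o(3,4)]
           in auto)
  qed
  then show ?thesis
    using F G types by (auto simp: qfunctor_def compose_def)
qed

end

lemma qisomorphism_retraction_iff:
  assumes R: "qfunctor Q M W R" and E: "qfunctor Q W M E"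
    and RE: "\<And>w. w \<in> Obj W \<Longrightarrow> R (E w) = w"
  shows "qisomorphism Q M W R \<longleftrightarrow> inj_on R (Obj M)"
    and "qisomorphism Q W M E \<longleftrightarrow> inj_on R (Obj M)"
proof -
  have oR: "R m \<in> Obj W" if "m \<in> Obj M" for m using R that by (auto simp: qfunctor_def)
  have oE: "E w \<in> Obj M" if "w \<in> Obj W" for w using E that by (auto simp: qfunctor_def)
  have W: "compose (Obj W) R E = functor_id W"
    using RE by (auto simp: compose_def functor_id_def intro!: restrict_ext)
  have M: "compose (Obj M) E R = functor_id M" if inj: "inj_on R (Obj M)"
  proof -
    have "E (R m) = m" if "m \<in> Obj M" for m
      using inj_onD[OF inj _ oE[OF oR[OF that]] that] RE[OF oR[OF that]] by simp
    then show ?thesis by (auto simp: compose_def functor_id_def intro!: restrict_ext)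
  qed
  have 1: "inj_on R (Obj M)" if "qisomorphism Q M W R"
  proof -
    obtain G where G: "compose (Obj M) G R = functor_id M"
      using \<open>qisomorphism Q M W R\<close> by (auto simp: qisomorphism_def)
    have "G (R m) = m" if "m \<in> Obj M" for m
      using fun_cong[OF G, of m] that by (simp add: compose_def functor_id_def)
    then show ?thesis by (rule inj_on_inverseI)
  qed
  have 2: "inj_on R (Obj M)" if "qisomorphism Q W M E"
  proof -
    obtain G where G: "qfunctor Q M W G" "compose (Obj M) E G = functor_id M"
      using \<open>qisomorphism Q W M E\<close> by (auto simp: qisomorphism_def)
    have "E (G m) = m" "G m \<in> Obj W" if "m \<in> Obj M" for m
      using fun_cong[OF G(2), of m] that G(1) by (auto simp: compose_def functor_id_def qfunctor_def)
    then have "E (R m) = m" if "m \<in> Obj M" for m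
      using RE that by metis
    then show ?thesis by (rule inj_on_inverseI)
  qed
  show "qisomorphism Q M W R \<longleftrightarrow> inj_on R (Obj M)"
    "qisomorphism Q W M E \<longleftrightarrow> inj_on R (Obj M)"
    using 1 2 M W R E by (auto simp: qisomorphism_def)
qed

text \<open>
  In the application \<open>K, K'\<close> are the restrictions and \<open>J, J'\<close> the inclusions of the square of
  right adjoints, and \<open>L, L', G, G'\<close> are the corresponding left adjoints.  Injectivity of
  either composite makes the two composites equal, so it passes from one to the other.
\<close>

lemma retract_square_inj_on_iff:
  assumes K: "K \<in> M \<rightarrow> N" and G: "G \<in> N \<rightarrow> W" and G': "G' \<in> M \<rightarrow> P" and K': "K' \<in> P \<rightarrow> W"
    and L: "L \<in> N \<rightarrow> M" and L': "L' \<in> W \<rightarrow> P" and J: "J \<in> W \<rightarrow> N" and J': "J' \<in> P \<rightarrow> M"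
    and KL: "\<And>n. n \<in> N \<Longrightarrow> K (L n) = n" and KL': "\<And>w. w \<in> W \<Longrightarrow> K' (L' w) = w"
    and GJ: "\<And>w. w \<in> W \<Longrightarrow> G (J w) = w" and GJ': "\<And>p. p \<in> P \<Longrightarrow> G' (J' p) = p"
    and square: "\<And>p. p \<in> P \<Longrightarrow> J (K' p) = K (J' p)"
  shows "inj_on (G \<circ> K) M \<longleftrightarrow> inj_on (K' \<circ> G') M"
proof
  assume inj: "inj_on (G \<circ> K) M"
  \<comment> \<open>As \<open>K\<close> is onto, \<open>G\<close> inherits injectivity, and its section \<open>J\<close> becomes an inverse.\<close>
  have JG: "J (G n) = n" if n: "n \<in> N" for n
  proof -
    have "(G \<circ> K) (L (J (G n))) = (G \<circ> K) (L n)"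
      using n KL GJ G J by (simp add: Pi_iff)
    then have "L (J (G n)) = L n"
      using inj n L J G by (auto simp: inj_on_def Pi_iff)
    then show ?thesis using KL n G J by (metis PiE)
  qed
  have "(K' \<circ> G') m = (G \<circ> K) m" if m: "m \<in> M" for m
  proof -
    \<comment> \<open>By the square, \<open>K\<close> identifies this element with \<open>m\<close>, so it is \<open>m\<close> and \<open>m\<close> lies in the image of \<open>J'\<close>.\<close>
    let ?m = "J' (L' (G (K m)))"
    have o: "K m \<in> N" "G (K m) \<in> W" "L' (G (K m)) \<in> P" "?m \<in> M"
      using m K G L' J' by (auto simp: Pi_iff)
    have "K ?m = K m"
      using square[OF o(3), symmetric] KL'[OF o(2)] JG[OF o(1)] by simp
    then have "?m = m"
      using inj m o by (auto simp: inj_on_def)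
    then have "G' m = L' (G (K m))"
      using GJ'[OF o(3)] by simp
    then show ?thesis using KL'[OF o(2)] by simp
  qed
  then show "inj_on (K' \<circ> G') M"
    using inj inj_on_cong by blast
next
  assume inj: "inj_on (K' \<circ> G') M"
  have "(G \<circ> K) m = (K' \<circ> G') m" if m: "m \<in> M" for m
  proof -
    have o: "G' m \<in> P" "J' (G' m) \<in> M" "K' (G' m) \<in> W"
      using m G' J' K' by (auto simp: Pi_iff)
    have "J' (G' m) = m"
      using inj m o GJ'[OF o(1)] by (auto simp: inj_on_def)
    then have "K m = J (K' (G' m))"
      using square[OF o(1)] by simp
    then show ?thesis using GJ[OF o(3)] by simp
  qed
  then show "inj_on (G \<circ> K) M"
    using inj inj_on_cong by blast
qed


section \<open>Presheaves and concept categories\<close>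

context quantaloid
begin

lemma star_sel [simp]:
  "Obj (star Q X) = {()}" "Typ (star Q X) u = X" "Arr (star Q X) u v = Ident Q X"
  by (simp_all add: star_def)

lemma qcategory_star: "X \<in> Ob Q \<Longrightarrow> qcategory Q (star Q X)"
  by (simp add: qcategory_def ident_closed comp_ident_left hom_refl)

lemma PSh_sel [simp]:
  "m \<in> Obj (PSh Q A) \<longleftrightarrow> fst m \<in> Ob Q \<and> snd m \<in> Dist Q A (star Q (fst m))"
  "Typ (PSh Q A) = fst"
  "Arr (PSh Q A) m n = left_impl Q A (star Q (fst m)) (star Q (fst n)) (snd n) (snd m) () ()"
  by (auto simp: PSh_def case_prod_beta)

lemma M_cat_sel [simp]:
  "m \<in> Obj (M_cat Q A B \<phi>) \<longleftrightarrow> fst m \<in> Ob Q \<and> snd m \<in> Dist Q A (star Q (fst m)) \<and>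
     right_impl Q A (star Q (fst m)) B (left_impl Q A (star Q (fst m)) B \<phi> (snd m)) \<phi> = snd m"
  "Typ (M_cat Q A B \<phi>) = fst"
  "Arr (M_cat Q A B \<phi>) m n = left_impl Q A (star Q (fst m)) (star Q (fst n)) (snd n) (snd m) () ()"
  by (auto simp: M_cat_def isbell_up_def isbell_down_def case_prod_beta prod_eq_iff)

text \<open>
  The hom-arrow from \<open>\<mu>\<close> to \<open>\<nu>\<close> is \<open>\<nu> \<swarrow> \<mu>\<close>, and \<open>1 \<le> \<nu> \<swarrow> \<mu>\<close> says \<open>1 \<circ> \<mu> \<le> \<nu>\<close>.
\<close>

lemma qle_PSh_iff:
  assumes A: "qcategory Q A" and m: "m \<in> Obj (PSh Q A)" and n: "n \<in> Obj (PSh Q A)"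
  shows "qle Q (PSh Q A) m n \<longleftrightarrow>
    fst m = fst n \<and> dist_le Q A (star Q (fst m)) (snd m) (snd n)"
proof (cases "fst m = fst n")
  case True
  let ?X = "fst m" and ?\<mu> = "snd m" and ?\<nu> = "snd n"
  have X: "?X \<in> Ob Q" and \<mu>: "?\<mu> \<in> Dist Q A (star Q ?X)" and \<nu>: "?\<nu> \<in> Dist Q A (star Q ?X)"
    using m n True by auto
  note S = qcategory_star[OF X]
  have "qle Q (PSh Q A) m n \<longleftrightarrow> dist_le Q (star Q ?X) (star Q ?X) (dist_id (star Q ?X))
          (left_impl Q A (star Q ?X) (star Q ?X) ?\<nu> ?\<mu>)"
    using True by (simp add: qle_def dist_le_def dist_id_def)
  also have "\<dots> \<longleftrightarrow> dist_le Q A (star Q ?X)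
      (dist_comp Q A (star Q ?X) (star Q ?X) (dist_id (star Q ?X)) ?\<mu>) ?\<nu>"
    using le_left_impl_iff[OF A S S \<mu> \<nu> dist_id_closed[OF S]] .
  also have "\<dots> \<longleftrightarrow> dist_le Q A (star Q ?X) ?\<mu> ?\<nu>"
    using comp_ident_left[OF Typ_Ob[OF A] X] X dist_carrier[OF \<mu>]
    by (subst dist_comp_le_iff[OF A S S dist_carrier[OF \<mu>] dist_carrier[OF dist_id_closed[OF S]]
          dist_carrier[OF \<nu>]]) (simp_all add: dist_le_def dist_id_def)
  finally show ?thesis using True by simp
qed (simp add: qle_def)

lemma qcategory_PSh:
  assumes A: "qcategory Q A"
  shows "qcategory Q (PSh Q A)"
proof -
  have c: "Arr (PSh Q A) m n \<in> carrier (Hom Q (fst m) (fst n))"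
    if m: "m \<in> Obj (PSh Q A)" and n: "n \<in> Obj (PSh Q A)" for m n
    using dist_carrier[OF left_impl_closed[OF A qcategory_star qcategory_star], of "fst m" "fst n" "snd m" "snd n" "()" "()"]
      m n by simp
  have i: "Ident Q (fst m) \<sqsubseteq>\<^bsub>Hom Q (fst m) (fst m)\<^esub> Arr (PSh Q A) m m"
    if m: "m \<in> Obj (PSh Q A)" for m
  proof -
    have "qle Q (PSh Q A) m m"
      using m dist_le_refl[OF A qcategory_star] by (subst qle_PSh_iff[OF A m m]) auto
    then show ?thesis by (simp add: qle_def)
  qed
  have t: "Comp Q (fst m) (fst n) (fst p) (Arr (PSh Q A) n p) (Arr (PSh Q A) m n)
          \<sqsubseteq>\<^bsub>Hom Q (fst m) (fst p)\<^esub> Arr (PSh Q A) m p"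
    if m: "m \<in> Obj (PSh Q A)" and n: "n \<in> Obj (PSh Q A)" and p: "p \<in> Obj (PSh Q A)" for m n p
  proof -
    let ?X = "star Q (fst m)" and ?Y = "star Q (fst n)" and ?Z = "star Q (fst p)"
    have S: "qcategory Q ?X" "qcategory Q ?Y" "qcategory Q ?Z"
      and d: "snd m \<in> Dist Q A ?X" "snd n \<in> Dist Q A ?Y" "snd p \<in> Dist Q A ?Z"
      using m n p qcategory_star by auto
    note f = left_impl_closed[OF A S(1,2) d(1,2)] left_impl_closed[OF A S(2,3) d(2,3)]
      left_impl_closed[OF A S(1,3) d(1,3)]
    show ?thesis
      using left_impl_comp_le[OF A S d]
        dist_comp_le_iff[OF S dist_carrier[OF f(1)] dist_carrier[OF f(2)] dist_carrier[OF f(3)]]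
      by simp
  qed
  show ?thesis
    unfolding qcategory_def using c i t by simp
qed

lemma qcategory_M_cat: "qcategory Q A \<Longrightarrow> qcategory Q (M_cat Q A B \<phi>)"
  unfolding M_cat_def by (rule qcategory_full_sub[OF qcategory_PSh]) auto

lemma M_cat_skeletal:
  assumes A: "qcategory Q A" and m: "m \<in> Obj (M_cat Q A B \<phi>)" and n: "n \<in> Obj (M_cat Q A B \<phi>)"
    and le: "qle Q (M_cat Q A B \<phi>) m n" "qle Q (M_cat Q A B \<phi>) n m"
  shows "m = n"
proof -
  have p: "m \<in> Obj (PSh Q A)" "n \<in> Obj (PSh Q A)"
    using m n by auto
  have "qle Q (PSh Q A) = qle Q (M_cat Q A B \<phi>)"
    by (simp add: qle_def fun_eq_iff)
  then have "qle Q (PSh Q A) m n" "qle Q (PSh Q A) n m"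
    using le by simp_all
  then show ?thesis
    using qle_PSh_iff[OF A p] qle_PSh_iff[OF A p(2,1)] p dist_antisym[OF A qcategory_star]
    by (auto intro!: prod_eqI)
qed


section \<open>The adjunction of a Chu connection\<close>

lemma right_impl_mem_M_cat:
  assumes A: "qcategory Q A" and B: "qcategory Q B" and \<phi>: "\<phi> \<in> Dist Q A B"
    and X: "X \<in> Ob Q" and \<kappa>: "\<kappa> \<in> Dist Q (star Q X) B"
  shows "(X, right_impl Q A (star Q X) B \<kappa> \<phi>) \<in> Obj (M_cat Q A B \<phi>)"
  using X right_impl_closed[OF A qcategory_star[OF X] B \<kappa> \<phi>]
    right_impl_isbell_closure[OF A B qcategory_star[OF X] \<phi> \<kappa>] by simp

lemma M_map_eq:
  "m \<in> Obj (M_cat Q C D \<psi>) \<Longrightarrow> M_map Q A B \<phi> C D \<psi> (\<zeta>, \<eta>) m =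
     (fst m, right_impl Q A (star Q (fst m)) B
       (left_impl Q A (star Q (fst m)) B \<phi> (dist_comp Q A C (star Q (fst m)) (snd m) \<zeta>)) \<phi>)"
  by (simp add: M_map_def isbell_up_def isbell_down_def)

text \<open>
  A concept of \<open>\<phi>\<close> is a presheaf \<open>\<nu> = \<kappa> \<searrow> \<phi>\<close> with \<open>\<kappa> = \<phi> \<swarrow> \<nu>\<close>.  The defining equation of a
  Chu connection sends it to a concept of \<open>\<psi>\<close>, as
  \<open>\<nu> \<swarrow> \<zeta> = \<kappa> \<searrow> (\<phi> \<swarrow> \<zeta>) = \<kappa> \<searrow> (\<eta> \<searrow> \<psi>) = (\<eta> \<circ> \<kappa>) \<searrow> \<psi>\<close>.
  The adjunction combines two facts: hom-arrows into a concept cannot distinguish a presheaf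
  from its closure, and \<open>\<nu> \<swarrow> (\<mu> \<circ> \<zeta>) = (\<nu> \<swarrow> \<zeta>) \<swarrow> \<mu>\<close>.
\<close>

lemma M_map_adjunction:
  assumes A: "qcategory Q A" and B: "qcategory Q B" and C: "qcategory Q C" and D: "qcategory Q D"
    and \<phi>: "\<phi> \<in> Dist Q A B" and \<psi>: "\<psi> \<in> Dist Q C D"
    and chu: "chu_connection Q A B \<phi> C D \<psi> (\<zeta>, \<eta>)"
  shows "qadjunction Q (M_cat Q C D \<psi>) (M_cat Q A B \<phi>) (M_map Q A B \<phi> C D \<psi> (\<zeta>, \<eta>))
           (\<lambda>n\<in>Obj (M_cat Q A B \<phi>). (fst n, left_impl Q A C (star Q (fst n)) (snd n) \<zeta>))"
    (is "qadjunction Q ?M ?N ?F ?G")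
proof -
  have \<zeta>: "\<zeta> \<in> Dist Q A C" and \<eta>: "\<eta> \<in> Dist Q B D"
    and eq: "left_impl Q A C B \<phi> \<zeta> = right_impl Q C B D \<eta> \<psi>"
    using chu by (auto simp: chu_connection_def)
  have G: "?G n \<in> Obj ?M" if n: "n \<in> Obj ?N" for n
  proof -
    let ?X = "star Q (fst n)" and ?\<kappa> = "left_impl Q A (star Q (fst n)) B \<phi> (snd n)"
    have X: "fst n \<in> Ob Q" and \<nu>: "snd n \<in> Dist Q A ?X"
      and fix_n: "right_impl Q A ?X B ?\<kappa> \<phi> = snd n"
      using n by auto
    note S = qcategory_star[OF X] and \<kappa> = left_impl_closed[OF A qcategory_star[OF X] B \<nu> \<phi>]
    have "left_impl Q A C ?X (snd n) \<zeta> = right_impl Q C ?X B ?\<kappa> (left_impl Q A C B \<phi> \<zeta>)"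
      using left_impl_right_impl[OF A C S B \<zeta> \<kappa> \<phi>] fix_n by simp
    also have "\<dots> = right_impl Q C ?X D (dist_comp Q ?X B D \<eta> ?\<kappa>) \<psi>"
      using right_impl_right_impl[OF C S B D \<kappa> \<eta> \<psi>] eq by simp
    finally show ?thesis
      using right_impl_mem_M_cat[OF C D \<psi> X dist_comp_closed[OF S B D \<kappa> \<eta>]] n
      by (simp del: M_cat_sel)
  qed
  have F: "?F m \<in> Obj ?N" if m: "m \<in> Obj ?M" for m
  proof -
    have X: "fst m \<in> Ob Q" and \<mu>: "snd m \<in> Dist Q C (star Q (fst m))"
      using m by auto
    note S = qcategory_star[OF X]
    show ?thesis
      unfolding M_map_eq[OF m]
      by (intro right_impl_mem_M_cat[OF A B \<phi> X] left_impl_closed[OF A S B _ \<phi>]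
          dist_comp_closed[OF A C S \<zeta> \<mu>])
  qed
  show ?thesis
  proof (rule qadjunctionI)
    show "qcategory Q ?M" "qcategory Q ?N"
      using C A qcategory_M_cat by auto
    show "?F \<in> Obj ?M \<rightarrow>\<^sub>E Obj ?N"
      using F by (auto simp: M_map_def simp del: M_cat_sel)
    show "?G \<in> Obj ?N \<rightarrow>\<^sub>E Obj ?M"
      using G by (simp add: PiE_iff del: M_cat_sel)
    show "Typ ?N (?F m) = Typ ?M m" if "m \<in> Obj ?M" for m
      by (simp add: M_map_eq[OF that])
    show "Typ ?M (?G n) = Typ ?N n" if "n \<in> Obj ?N" for n
      using that by (simp del: M_cat_sel(1))
    show "Arr ?N (?F m) n = Arr ?M m (?G n)" if m: "m \<in> Obj ?M" and n: "n \<in> Obj ?N" for m n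
    proof -
      let ?X = "star Q (fst m)" and ?Y = "star Q (fst n)"
      let ?\<kappa> = "left_impl Q A ?Y B \<phi> (snd n)" and ?\<theta> = "dist_comp Q A C ?X (snd m) \<zeta>"
      let ?cl = "right_impl Q A ?X B (left_impl Q A ?X B \<phi> ?\<theta>) \<phi>"
      have Y: "fst n \<in> Ob Q" and \<nu>: "snd n \<in> Dist Q A ?Y"
        and fix_n: "right_impl Q A ?Y B ?\<kappa> \<phi> = snd n"
        and X: "fst m \<in> Ob Q" and \<mu>: "snd m \<in> Dist Q C ?X"
        using m n by auto
      note SX = qcategory_star[OF X] and SY = qcategory_star[OF Y]
      note \<kappa> = left_impl_closed[OF A SY B \<nu> \<phi>] and \<theta> = dist_comp_closed[OF A C SX \<zeta> \<mu>]
      note u\<theta> = left_impl_closed[OF A SX B \<theta> \<phi>]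
      note cl = right_impl_closed[OF A SX B u\<theta> \<phi>]
      have "left_impl Q A ?X ?Y (snd n) ?cl = right_impl Q ?X ?Y B ?\<kappa> (left_impl Q A ?X B \<phi> ?cl)"
        using left_impl_right_impl[OF A SX SY B cl \<kappa> \<phi>] fix_n by simp
      also have "\<dots> = right_impl Q ?X ?Y B ?\<kappa> (left_impl Q A ?X B \<phi> ?\<theta>)"
        using left_impl_isbell_closure[OF A B SX \<phi> \<theta>] by simp
      also have "\<dots> = left_impl Q A ?X ?Y (snd n) ?\<theta>"
        using left_impl_right_impl[OF A SX SY B \<theta> \<kappa> \<phi>] fix_n by simp
      also have "\<dots> = left_impl Q C ?X ?Y (left_impl Q A C ?Y (snd n) \<zeta>) (snd m)"
        using left_impl_left_impl[OF A C SX SY \<zeta> \<mu> \<nu>] by simp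
      finally show ?thesis
        using n by (simp add: M_map_eq[OF m] del: M_cat_sel(1))
    qed
  qed
qed

text \<open>
  When \<open>\<phi> \<swarrow> \<zeta> = \<psi>\<close>, the left adjoint is fully faithful: \<open>\<mu> \<circ> \<zeta>\<close> and \<open>\<mu>\<close> have the same
  upper part \<open>\<phi> \<swarrow> (\<mu> \<circ> \<zeta>) = \<psi> \<swarrow> \<mu>\<close>, and \<open>\<swarrow> \<zeta>\<close> carries the \<open>\<phi>\<close>-concept with this upper
  part to the \<open>\<psi>\<close>-concept with this upper part.
\<close>

lemma left_impl_M_map:
  assumes A: "qcategory Q A" and B: "qcategory Q B" and C: "qcategory Q C"
    and \<phi>: "\<phi> \<in> Dist Q A B" and \<zeta>: "\<zeta> \<in> Dist Q A C" and eq: "left_impl Q A C B \<phi> \<zeta> = \<psi>"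
    and m: "m \<in> Obj (M_cat Q C B \<psi>)"
  shows "left_impl Q A C (star Q (fst m)) (snd (M_map Q A B \<phi> C B \<psi> (\<zeta>, \<eta>) m)) \<zeta> = snd m"
proof -
  let ?X = "star Q (fst m)" and ?\<theta> = "dist_comp Q A C (star Q (fst m)) (snd m) \<zeta>"
  have X: "fst m \<in> Ob Q" and \<mu>: "snd m \<in> Dist Q C ?X"
    and fix_m: "right_impl Q C ?X B (left_impl Q C ?X B \<psi> (snd m)) \<psi> = snd m"
    using m by auto
  note S = qcategory_star[OF X]
  note u = left_impl_closed[OF A S B dist_comp_closed[OF A C S \<zeta> \<mu>] \<phi>]
  have "left_impl Q A C ?X (right_impl Q A ?X B (left_impl Q A ?X B \<phi> ?\<theta>) \<phi>) \<zeta>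
      = right_impl Q C ?X B (left_impl Q A ?X B \<phi> ?\<theta>) \<psi>"
    using left_impl_right_impl[OF A C S B \<zeta> u \<phi>] eq by simp
  also have "\<dots> = right_impl Q C ?X B (left_impl Q C ?X B \<psi> (snd m)) \<psi>"
    using left_impl_left_impl[OF A C S B \<zeta> \<mu> \<phi>] eq by simp
  also have "\<dots> = snd m"
    by (rule fix_m)
  finally show ?thesis
    by (simp add: M_map_eq[OF m])
qed

lemma M_map_dist_id:
  assumes A: "qcategory Q A" and B: "qcategory Q B" and \<phi>: "\<phi> \<in> Dist Q A B"
    and m: "m \<in> Obj (M_cat Q A B \<phi>)" and m': "m \<in> Obj (M_cat Q A D \<psi>)"
  shows "M_map Q A B \<phi> A D \<psi> (dist_id A, \<eta>) m = m"
proof -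
  let ?X = "star Q (fst m)"
  have X: "fst m \<in> Ob Q" and \<mu>: "snd m \<in> Dist Q A ?X"
    and fix_m: "right_impl Q A ?X B (left_impl Q A ?X B \<phi> (snd m)) \<phi> = snd m"
    using m by auto
  note S = qcategory_star[OF X]
  have "left_impl Q A ?X B \<phi> (dist_comp Q A A ?X (snd m) (dist_id A))
      = left_impl Q A ?X B \<phi> (snd m)"
    using left_impl_left_impl[OF A A S B dist_id_closed[OF A] \<mu> \<phi>] left_impl_dist_id[OF A B \<phi>]
    by simp
  then show ?thesis
    using fix_m by (simp add: M_map_eq[OF m'] prod_eq_iff)
qed


section \<open>Restriction and inclusion of concept categories\<close>

lemma M_sub_Obj: "\<phi> \<in> Dist Q A B \<Longrightarrow> M_sub Q A B \<phi> (Obj A) (Obj B) = M_cat Q A B \<phi>"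
  by (simp add: M_sub_def dist_restrict_Obj)

lemma qcategory_M_sub:
  "\<lbrakk>qcategory Q A; S \<subseteq> Obj A\<rbrakk> \<Longrightarrow> qcategory Q (M_sub Q A B \<phi> S T)"
  unfolding M_sub_def by (intro qcategory_M_cat qcategory_full_sub)

lemma M_incl_dom_adjunction:
  assumes A: "qcategory Q A" and B: "qcategory Q B" and \<phi>: "\<phi> \<in> Dist Q A B"
    and S: "S \<subseteq> Obj A" and T: "T \<subseteq> Obj B"
  defines "K \<equiv> \<lambda>m\<in>Obj (M_sub Q A B \<phi> (Obj A) T). (fst m, dist_restrict S UNIV (snd m))"
  shows "qadjunction Q (M_sub Q A B \<phi> S T) (M_sub Q A B \<phi> (Obj A) T) (M_incl_dom Q A B \<phi> S T) K"
    and "m \<in> Obj (M_sub Q A B \<phi> S T) \<Longrightarrow> K (M_incl_dom Q A B \<phi> S T m) = m"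
proof -
  let ?A = "full_sub A S" and ?B = "full_sub B T"
  let ?\<phi> = "dist_restrict (Obj A) T \<phi>" and ?\<psi> = "dist_restrict S T \<phi>"
  have A': "qcategory Q ?A" and B': "qcategory Q ?B"
    using qcategory_full_sub[OF A S] qcategory_full_sub[OF B T] by auto
  have \<phi>': "?\<phi> \<in> Dist Q A ?B" and \<psi>: "?\<psi> \<in> Dist Q ?A ?B"
    using dist_restrict_closed[OF \<phi> subset_refl T] dist_restrict_closed[OF \<phi> S T] by auto
  have M: "M_sub Q A B \<phi> (Obj A) T = M_cat Q A ?B ?\<phi>" "M_sub Q A B \<phi> S T = M_cat Q ?A ?B ?\<psi>"
    by (simp_all add: M_sub_def)
  note chu = chu_connection_incl_dom[OF A B \<phi> S T]
  have restr: "left_impl Q A ?A (star Q (fst m)) (snd m) (incl_cograph A S) = dist_restrict S UNIV (snd m)"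
    if "m \<in> Obj (PSh Q A)" for m
    using left_impl_incl[OF A qcategory_star _ S, of "fst m" "snd m"] that by (simp add: UNIV_unit)
  have K: "K = (\<lambda>n\<in>Obj (M_cat Q A ?B ?\<phi>).
      (fst n, left_impl Q A ?A (star Q (fst n)) (snd n) (incl_cograph A S)))"
    unfolding K_def M using restr by (intro restrict_ext) simp
  show adj: "qadjunction Q (M_sub Q A B \<phi> S T) (M_sub Q A B \<phi> (Obj A) T) (M_incl_dom Q A B \<phi> S T) K"
    unfolding M K M_incl_dom_def by (rule M_map_adjunction[OF A B' A' B' \<phi>' \<psi> chu])
  assume m: "m \<in> Obj (M_sub Q A B \<phi> S T)"
  have eq: "left_impl Q A ?A ?B ?\<phi> (incl_cograph A S) = ?\<psi>"
  proof -
    have "dist_restrict S T (dist_restrict (Obj A) T \<phi>) = dist_restrict S T \<phi>"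
      using S by (auto simp: dist_restrict_def intro!: restrict_ext)
    then show ?thesis
      using left_impl_incl[OF A B' \<phi>' S] by simp
  qed
  have "M_incl_dom Q A B \<phi> S T m \<in> Obj (M_sub Q A B \<phi> (Obj A) T)"
    using adj m by (auto simp: qadjunction_def qfunctor_def)
  moreover have "fst (M_incl_dom Q A B \<phi> S T m) = fst m"
    using m unfolding M_incl_dom_def M by (simp only: M_map_eq fst_conv)
  ultimately show "K (M_incl_dom Q A B \<phi> S T m) = m"
    using left_impl_M_map[OF A B' A' \<phi>' incl_cograph_closed[OF A S] eq, of m] m
    unfolding M_incl_dom_def M K by (simp add: prod_eq_iff del: M_cat_sel)
qed

lemma M_incl_cod:
  assumes A: "qcategory Q A" and B: "qcategory Q B" and \<phi>: "\<phi> \<in> Dist Q A B"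
    and S: "S \<subseteq> Obj A" and T: "T \<subseteq> Obj B"
  shows M_incl_cod_adjunction: "qadjunction Q (M_sub Q A B \<phi> S (Obj B)) (M_sub Q A B \<phi> S T)
       (M_incl_cod Q A B \<phi> S T) (\<lambda>m\<in>Obj (M_sub Q A B \<phi> S T). m)"
    and M_incl_cod_ident: "m \<in> Obj (M_sub Q A B \<phi> S T) \<Longrightarrow> M_incl_cod Q A B \<phi> S T m = m"
proof -
  let ?A = "full_sub A S" and ?B = "full_sub B T"
  let ?\<phi> = "dist_restrict S (Obj B) \<phi>" and ?\<psi> = "dist_restrict S T \<phi>"
  have A': "qcategory Q ?A" and B': "qcategory Q ?B"
    using qcategory_full_sub[OF A S] qcategory_full_sub[OF B T] by auto
  have \<phi>': "?\<phi> \<in> Dist Q ?A B" and \<psi>: "?\<psi> \<in> Dist Q ?A ?B"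
    using dist_restrict_closed[OF \<phi> S subset_refl] dist_restrict_closed[OF \<phi> S T] by auto
  have M: "M_sub Q A B \<phi> S (Obj B) = M_cat Q ?A B ?\<phi>" "M_sub Q A B \<phi> S T = M_cat Q ?A ?B ?\<psi>"
    by (simp_all add: M_sub_def)
  note chu = chu_connection_incl_cod[OF A B \<phi> S T]
  have J: "(\<lambda>n\<in>Obj (M_cat Q ?A ?B ?\<psi>). n) = (\<lambda>n\<in>Obj (M_cat Q ?A ?B ?\<psi>).
      (fst n, left_impl Q ?A ?A (star Q (fst n)) (snd n) (dist_id ?A)))"
    using left_impl_dist_id[OF A' qcategory_star] by (intro restrict_ext) simp
  show adj: "qadjunction Q (M_sub Q A B \<phi> S (Obj B)) (M_sub Q A B \<phi> S T)
       (M_incl_cod Q A B \<phi> S T) (\<lambda>m\<in>Obj (M_sub Q A B \<phi> S T). m)"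
    unfolding M J M_incl_cod_def by (rule M_map_adjunction[OF A' B' A' B \<psi> \<phi>' chu])
  assume m: "m \<in> Obj (M_sub Q A B \<phi> S T)"
  then have "m \<in> Obj (M_sub Q A B \<phi> S (Obj B))"
    using adj by (auto simp: qadjunction_def qfunctor_def)
  then show "M_incl_cod Q A B \<phi> S T m = m"
    using m M_map_dist_id[OF A' B' \<psi>] unfolding M_incl_cod_def M by blast
qed

end

theorem theorem4p1p1:
  fixes Q :: "('o, 'a) quantaloid_data"
    and A :: "('x, 'o, 'a) qcat" and B :: "('y, 'o, 'a) qcat"
    and \<phi> :: "'x \<Rightarrow> 'y \<Rightarrow> 'a" and S :: "'x set" and T :: "'y set"
  assumes "quantaloid Q" and "qcategory Q A" and "qcategory Q B"
    and "\<phi> \<in> Dist Q A B" and "S \<subseteq> Obj A" and "T \<subseteq> Obj B"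
    and "qisomorphism Q (M_cat Q A B \<phi>) (M_sub Q A B \<phi> S T) (comparison_R1 Q A B \<phi> S T) \<or>
         qisomorphism Q (M_cat Q A B \<phi>) (M_sub Q A B \<phi> S T) (comparison_R2 Q A B \<phi> S T) \<or>
         qisomorphism Q (M_sub Q A B \<phi> S T) (M_cat Q A B \<phi>) (comparison_E1 Q A B \<phi> S T) \<or>
         qisomorphism Q (M_sub Q A B \<phi> S T) (M_cat Q A B \<phi>) (comparison_E2 Q A B \<phi> S T)"
  shows "qisomorphism Q (M_cat Q A B \<phi>) (M_sub Q A B \<phi> S T) (comparison_R1 Q A B \<phi> S T) \<and>
         qisomorphism Q (M_cat Q A B \<phi>) (M_sub Q A B \<phi> S T) (comparison_R2 Q A B \<phi> S T) \<and>
         qisomorphism Q (M_sub Q A B \<phi> S T) (M_cat Q A B \<phi>) (comparison_E1 Q A B \<phi> S T) \<and>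
         qisomorphism Q (M_sub Q A B \<phi> S T) (M_cat Q A B \<phi>) (comparison_E2 Q A B \<phi> S T)"
proof -
  interpret quantaloid Q by fact
  note A = assms(2) and B = assms(3) and \<phi> = assms(4) and S = assms(5) and T = assms(6)
  let ?sub = "M_sub Q A B \<phi>"
  let ?M = "M_cat Q A B \<phi>" and ?N = "?sub S (Obj B)" and ?P = "?sub (Obj A) T" and ?W = "?sub S T"
  let ?L = "M_incl_dom Q A B \<phi> S (Obj B)" and ?L' = "M_incl_dom Q A B \<phi> S T"
  let ?G = "M_incl_cod Q A B \<phi> S T" and ?G' = "M_incl_cod Q A B \<phi> (Obj A) T"
  define K where "K = (\<lambda>m\<in>Obj ?M. (fst m, dist_restrict S UNIV (snd m)))"
  define K' where "K' = (\<lambda>m\<in>Obj ?P. (fst m, dist_restrict S UNIV (snd m)))"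
  define J where "J = (\<lambda>m\<in>Obj ?W. m)"
  define J' where "J' = (\<lambda>m\<in>Obj ?P. m)"
  note M = M_sub_Obj[OF \<phi>]
  have cat: "qcategory Q ?M" "qcategory Q ?N" "qcategory Q ?P" "qcategory Q ?W"
    using qcategory_M_cat[OF A] qcategory_M_sub[OF A S] qcategory_M_sub[OF A subset_refl] by auto
  have adj: "qadjunction Q ?N ?M ?L K" "qadjunction Q ?W ?P ?L' K'"
    "qadjunction Q ?N ?W ?G J" "qadjunction Q ?M ?P ?G' J'"
    using M_incl_dom_adjunction(1)[OF A B \<phi> S subset_refl] M_incl_dom_adjunction(1)[OF A B \<phi> S T]
      M_incl_cod_adjunction[OF A B \<phi> S T] M_incl_cod_adjunction[OF A B \<phi> subset_refl T]
    by (simp_all add: K_def K'_def J_def J'_def M)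
  have skel: "x = y" if "x \<in> Obj (?sub U V)" "y \<in> Obj (?sub U V)"
      "qle Q (?sub U V) x y" "qle Q (?sub U V) y x" "U \<subseteq> Obj A" for x y U V
    using that M_cat_skeletal[OF qcategory_full_sub[OF A]] unfolding M_sub_def by blast
  have ra: "right_adjoint Q ?N ?M ?L = K" "right_adjoint Q ?W ?P ?L' = K'"
    "right_adjoint Q ?N ?W ?G = J" "right_adjoint Q ?M ?P ?G' = J'"
    using right_adjoint_eqI[OF cat(2,1) _ adj(1)] right_adjoint_eqI[OF cat(4,3) _ adj(2)]
      right_adjoint_eqI[OF cat(2,4) _ adj(3)] right_adjoint_eqI[OF cat(1,3) _ adj(4)] skel S M
    by (metis subset_refl)+
  have functors: "qfunctor Q ?N ?M ?L" "qfunctor Q ?M ?N K" "qfunctor Q ?W ?P ?L'" "qfunctor Q ?P ?W K'"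
    "qfunctor Q ?N ?W ?G" "qfunctor Q ?W ?N J" "qfunctor Q ?M ?P ?G'" "qfunctor Q ?P ?M J'"
    using adj by (auto simp: qadjunction_def)
  have maps: "?L \<in> Obj ?N \<rightarrow> Obj ?M" "K \<in> Obj ?M \<rightarrow> Obj ?N" "?L' \<in> Obj ?W \<rightarrow> Obj ?P"
    "K' \<in> Obj ?P \<rightarrow> Obj ?W" "?G \<in> Obj ?N \<rightarrow> Obj ?W" "J \<in> Obj ?W \<rightarrow> Obj ?N"
    "?G' \<in> Obj ?M \<rightarrow> Obj ?P" "J' \<in> Obj ?P \<rightarrow> Obj ?M"
    using functors unfolding qfunctor_def by (auto simp: PiE_iff)
  have KL: "K (?L n) = n" if "n \<in> Obj ?N" for n
    using M_incl_dom_adjunction(2)[OF A B \<phi> S subset_refl that] by (simp add: K_def M)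
  have KL': "K' (?L' w) = w" if "w \<in> Obj ?W" for w
    using M_incl_dom_adjunction(2)[OF A B \<phi> S T that] by (simp add: K'_def)
  have GJ: "?G (J w) = w" if "w \<in> Obj ?W" for w
    using M_incl_cod_ident[OF A B \<phi> S T that] that by (simp add: J_def)
  have GJ': "?G' (J' p) = p" if "p \<in> Obj ?P" for p
    using M_incl_cod_ident[OF A B \<phi> subset_refl T that] that by (simp add: J'_def)
  have square: "J (K' p) = K (J' p)" if p: "p \<in> Obj ?P" for p
  proof -
    have "K' p \<in> Obj ?W" "p \<in> Obj ?M"
      using maps(4,8) p by (auto simp: J'_def Pi_iff)
    then show ?thesis
      using p by (simp add: J_def J'_def K_def K'_def del: M_cat_sel)
  qed
  have R: "comparison_R1 Q A B \<phi> S T = compose (Obj ?M) ?G K"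
    "comparison_R2 Q A B \<phi> S T = compose (Obj ?M) K' ?G'"
    "comparison_E1 Q A B \<phi> S T = compose (Obj ?W) ?L J"
    "comparison_E2 Q A B \<phi> S T = compose (Obj ?W) J' ?L'"
    by (simp_all add: comparison_R1_def comparison_R2_def comparison_E1_def comparison_E2_def ra)
  note comp = qfunctor_compose[OF functors(2,5) cat(1,2,4)] qfunctor_compose[OF functors(7,4) cat(1,3,4)]
    qfunctor_compose[OF functors(6,1) cat(4,2,1)] qfunctor_compose[OF functors(3,8) cat(4,3,1)]
  have 1: "compose (Obj ?M) ?G K (compose (Obj ?W) ?L J w) = w"
    and 2: "compose (Obj ?M) K' ?G' (compose (Obj ?W) J' ?L' w) = w" if w: "w \<in> Obj ?W" for w
    using w maps KL KL' GJ GJ' by (simp_all add: compose_def Pi_iff del: M_cat_sel)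
  have "inj_on (compose (Obj ?M) ?G K) (Obj ?M) \<longleftrightarrow> inj_on (compose (Obj ?M) K' ?G') (Obj ?M)"
    using retract_square_inj_on_iff[OF maps(2,5,7,4,1,3,6,8) KL KL' GJ GJ' square]
    by (simp add: inj_on_def compose_def)
  then show ?thesis
    using assms(7) qisomorphism_retraction_iff[OF comp(1,3) 1] qisomorphism_retraction_iff[OF comp(2,4) 2]
    unfolding R by blast
qed

end
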